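(* Let $\eta\ge 0$ and $T>0$. Consider solutions $(x_t,y_t)_{0\le t\le T}$ of $$\dot x=y-x|y|-2\eta x,\qquad -\dot y=x-\tfrac12 y|y|-2\eta y,\qquad x_0=0,\quad y_T=0$$ (the mean field game Nash equilibria of the follow the crowd game with zero terminal cost and initial value $\overline\theta=1/2$). (i) If $\eta\ge 1/2$, then $(x_t,y_t)\equiv(0,0)$ is the only solution. (ii) If $0\le\eta<1/2$, then, with $$T_c=T_c(\eta)=\frac{\pi-\arccos(2\eta)}{\sqrt{1-4\eta^2}},$$ the number of solutions is $$1+2\left\lceil\frac{(T-T_c)\sqrt{1-4\eta^2}}{\pi}\right\rceil .$$ In particular, for $T\le T_c(\eta)$ the zero solution is the unique solution.
   Context: In the follow the crowd game, $f(0,\theta)=1-\theta$ and $f(1,\theta)=\theta$. With terminal cost $\psi\equiv0$ and initial value $\overline\theta=1/2$, a mean field game Nash equilibrium over $[0,T]$ is a solution $(\theta_t,u(0,t),u(1,t))$ of $\dot\theta_t=(1-\theta_t)((u(1,t)-u(0,t))_+ +\eta)-\theta_t((u(0,t)-u(1,t))_+ +\eta)$, and $-\dot u(i,t)=f(i,\theta_t)-\eta(u(i,t)-u(1-i,t))-\frac12((u(i,t)-u(1-i,t))_+)^2$ for $i\in\{0,1\}$, with $\theta_0=\overline\theta$, $u(i,T)=0$, where $a_+=\max(a,0)$. The change of variables is $x=2\theta-1$, $y_t=u(1,t)-u(0,t)$; $(\theta,u)$ is recovered from $(x,y)$ by integration. Here $\lceil\cdot\rceil$ is the ceiling function. *)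

theory Defs
  imports Complex_Main "HOL-Library.FuncSet"
begin

text \<open>Trajectories over the time interval \<open>[0, T]\<close> are represented by functions in
  \<open>extensional {0..T}\<close>, so that two trajectories are equal as HOL functions iff they agree
  on \<open>[0, T]\<close>; without this the solution sets below could not be counted.  Derivatives are taken
  within \<open>[0, T]\<close>, i.e. they are one-sided at the end points.\<close>

text \<open>Players' states are \<open>0\<close> and \<open>1\<close>, so the other state is \<open>1 - i\<close>.\<close>

definition crowd_cost :: "nat \<Rightarrow> real \<Rightarrow> real" where
  "crowd_cost i \<theta> = (if i = 0 then 1 - \<theta> else \<theta>)"

definition mfg_equilibria :: "real \<Rightarrow> real \<Rightarrow> ((real \<Rightarrow> real) \<times> (nat \<Rightarrow> real \<Rightarrow> real)) set" where
  "mfg_equilibria \<eta> T = {(\<theta>, u).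
     \<theta> \<in> extensional {0..T} \<and>
     u \<in> (\<Pi>\<^sub>E i\<in>{0, 1}. extensional {0..T}) \<and>
     (\<forall>t\<in>{0..T}. (\<theta> has_real_derivative
        (1 - \<theta> t) * (max (u 1 t - u 0 t) 0 + \<eta>) - \<theta> t * (max (u 0 t - u 1 t) 0 + \<eta>))
        (at t within {0..T})) \<and>
     (\<forall>i\<in>{0, 1}. \<forall>t\<in>{0..T}. (u i has_real_derivative
        - (crowd_cost i (\<theta> t) - \<eta> * (u i t - u (1 - i) t)
             - 1 / 2 * (max (u i t - u (1 - i) t) 0)\<^sup>2))
        (at t within {0..T})) \<and>
     \<theta> 0 = 1 / 2 \<and>
     (\<forall>i\<in>{0, 1}. u i T = 0)}"

definition xy_solutions :: "real \<Rightarrow> real \<Rightarrow> ((real \<Rightarrow> real) \<times> (real \<Rightarrow> real)) set" where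
  "xy_solutions \<eta> T = {(x, y).
     x \<in> extensional {0..T} \<and> y \<in> extensional {0..T} \<and>
     (\<forall>t\<in>{0..T}. (x has_real_derivative y t - x t * \<bar>y t\<bar> - 2 * \<eta> * x t)
        (at t within {0..T})) \<and>
     (\<forall>t\<in>{0..T}. (y has_real_derivative - (x t - 1 / 2 * y t * \<bar>y t\<bar> - 2 * \<eta> * y t))
        (at t within {0..T})) \<and>
     x 0 = 0 \<and> y T = 0}"

definition to_xy ::
    "real \<Rightarrow> (real \<Rightarrow> real) \<times> (nat \<Rightarrow> real \<Rightarrow> real) \<Rightarrow> (real \<Rightarrow> real) \<times> (real \<Rightarrow> real)" where
  "to_xy T = (\<lambda>(\<theta>, u). (\<lambda>t\<in>{0..T}. 2 * \<theta> t - 1, \<lambda>t\<in>{0..T}. u 1 t - u 0 t))"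

definition zero_solution :: "real \<Rightarrow> (real \<Rightarrow> real) \<times> (real \<Rightarrow> real)" where
  "zero_solution T = (\<lambda>t\<in>{0..T}. 0, \<lambda>t\<in>{0..T}. 0)"

definition critical_time :: "real \<Rightarrow> real" where
  "critical_time \<eta> = (pi - arccos (2 * \<eta>)) / sqrt (1 - 4 * \<eta>\<^sup>2)"

end

theory Submission
  imports Defs "HOL-Analysis.Analysis"
begin

text \<open>The system is Hamiltonian, with energy \<open>x\<^sup>2 + y\<^sup>2 - 4 \<eta> x y - x y \<bar>y\<bar>\<close>.  For \<open>\<eta> < 1/2\<close>, elliptic
  polar coordinates adapted to the quadratic part, with an angle \<open>\<beta>\<close> and a function \<open>P \<beta>\<close> describing the
  cubic part, reduce the orbit from \<open>(0, a)\<close> to a quadrature: the time to reach the angle \<open>u\<close> is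
  \<open>1/\<omega>\<close> times the integral of \<open>G (a P \<beta>)\<close> over \<open>[0, u]\<close>, where \<open>G\<close> increases with slope \<open>3/2\<close> at \<open>0\<close>.
  The \<open>x\<close>-axis is met exactly at the angles \<open>(k + 1) \<pi> - \<gamma>\<close> with \<open>cos \<gamma> = 2 \<eta>\<close>.  Each of these
  hitting times is strictly increasing in \<open>a\<close>, because \<open>P\<close> has a positive integral up to such an
  angle; it tends to \<open>T\<^sub>c + k \<pi> / \<omega>\<close> as \<open>a\<close> tends to \<open>0\<close>, and to infinity as the orbit approaches the
  level of the saddle point, where \<open>P\<close> is maximal.  So every \<open>k\<close> with \<open>T\<^sub>c + k \<pi> / \<omega> < T\<close> contributes one
  \<open>a > 0\<close> and, by symmetry, one \<open>a < 0\<close>.  Orbits at or above the level of the saddle, and all orbits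
  if \<open>\<eta> \<ge> 1/2\<close>, are kept away from the \<open>x\<close>-axis by a ray which the energy forbids them to cross.\<close>

section \<open>Calculus: the function \<open>u * \<bar>u\<bar>\<close> and Gronwall's
  inequality\<close>

text \<open>At \<open>0\<close> the difference quotient is \<open>\<bar>h\<bar>\<close>; elsewhere
  the function agrees near \<open>u\<close> with the quadratic \<open>v * (sgn u * v)\<close>. As a
  derivative rule this spares case distinctions on the sign of \<open>y\<close>.\<close>

lemma has_real_derivative_mult_abs:
  "((\<lambda>u::real. u * \<bar>u\<bar>) has_real_derivative 2 * \<bar>u\<bar>) (at u within S)"
proof -
  have "((\<lambda>u::real. u * \<bar>u\<bar>) has_real_derivative 2 * \<bar>u\<bar>) (at u)"
  proof (cases "u = 0")
    case True
    have "((\<lambda>h::real. \<bar>h\<bar>) \<longlongrightarrow> 0) (at 0)"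
      by (intro tendsto_eq_intros) auto
    then have "((\<lambda>h::real. (h * \<bar>h\<bar>) / h) \<longlongrightarrow> 0) (at 0)"
      by (rule Lim_transform_eventually) (auto simp: eventually_at intro: exI[of _ 1])
    then show ?thesis
      using True by (simp add: DERIV_def)
  next
    case False
    have "((\<lambda>v::real. v * (sgn u * v)) has_real_derivative 2 * \<bar>u\<bar>) (at u)"
      by (auto intro!: derivative_eq_intros simp: sgn_if)
    moreover have "open {v. 0 < sgn u * v}" "u \<in> {v. 0 < sgn u * v}"
      using False by (auto simp: sgn_if intro!: open_Collect_less continuous_intros)
    ultimately show ?thesis
      by (rule has_field_derivative_transform_within_open) (auto simp: sgn_if zero_less_mult_iff split: if_splits)
  qed
  then show ?thesis
    by (rule has_field_derivative_at_within)
qed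

lemmas derivative_mult_abs [derivative_intros] =
  DERIV_chain2[OF has_real_derivative_mult_abs]

lemma deriv_nonneg_imp_le:
  fixes f :: "real \<Rightarrow> real"
  assumes "\<And>t. t \<in> {a..b} \<Longrightarrow> (f has_real_derivative f' t) (at t within {a..b})"
    and "\<And>t. t \<in> {a..b} \<Longrightarrow> 0 \<le> f' t"
    and "a \<le> b"
  shows "f a \<le> f b"
proof -
  obtain c where "c \<in> {a..b}" "f b - f a = f' c * (b - a)"
    using mvt_very_simple[of a b f "\<lambda>t h. f' t * h"] assms
    by (auto simp: has_field_derivative_def)
  then show ?thesis
    using assms by (metis diff_ge_0_iff_ge mult_nonneg_nonneg)
qed

text \<open>The bound makes \<open>D t * exp (- (L * t))\<close> nonincreasing and
  \<open>D t * exp (L * t)\<close> nondecreasing. The backward estimate limits how close an orbit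
  can come to an equilibrium in a given time.\<close>

lemma gronwall_abs:
  fixes D :: "real \<Rightarrow> real"
  assumes D: "\<And>t. t \<in> {a..b} \<Longrightarrow> (D has_real_derivative D' t) (at t within {a..b})"
    and bound: "\<And>t. t \<in> {a..b} \<Longrightarrow> \<bar>D' t\<bar> \<le> L * D t"
    and "a \<le> b"
  shows "D b \<le> D a * exp (L * (b - a))" and "D a \<le> D b * exp (L * (b - a))"
proof -
  have "- (D a * exp (- (L * a))) \<le> - (D b * exp (- (L * b)))"
    by (rule deriv_nonneg_imp_le[where f = "\<lambda>t. - (D t * exp (- (L * t)))"
          and f' = "\<lambda>t. (L * D t - D' t) * exp (- (L * t))"])
       (use bound \<open>a \<le> b\<close> in \<open>auto intro!: derivative_eq_intros D mult_nonneg_nonneg simp: abs_le_iff algebra_simps\<close>)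
  then have "D b * exp (- (L * b)) * exp (L * b) \<le> D a * exp (- (L * a)) * exp (L * b)"
    by simp
  then show "D b \<le> D a * exp (L * (b - a))"
    by (simp add: mult.assoc flip: exp_add) (simp add: algebra_simps)
  have "D a * exp (L * a) \<le> D b * exp (L * b)"
  proof (rule deriv_nonneg_imp_le[where f = "\<lambda>t. D t * exp (L * t)"
        and f' = "\<lambda>t. (L * D t + D' t) * exp (L * t)"])
    fix t assume "t \<in> {a..b}"
    then show "0 \<le> (L * D t + D' t) * exp (L * t)"
      using bound[of t] by (auto simp: abs_le_iff)
  qed (use \<open>a \<le> b\<close> in \<open>auto intro!: derivative_eq_intros D simp: algebra_simps\<close>)
  then have "D a * exp (L * a) * exp (- (L * a)) \<le> D b * exp (L * b) * exp (- (L * a))"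
    by simp
  then show "D a \<le> D b * exp (L * (b - a))"
    by (simp add: mult.assoc flip: exp_add) (simp add: algebra_simps)
qed

section \<open>Trajectories, uniqueness and conservation of energy\<close>

text \<open>Boundary values and extensionality are left out and the time domain is arbitrary, so
  that subintervals, equilibria and orbits defined for all times are covered alike.\<close>

definition xy_flow :: "real \<Rightarrow> real set \<Rightarrow> (real \<Rightarrow> real) \<Rightarrow> (real \<Rightarrow> real) \<Rightarrow> bool" where
  "xy_flow \<eta> I x y \<longleftrightarrow> (\<forall>t\<in>I.
     (x has_real_derivative y t - x t * \<bar>y t\<bar> - 2 * \<eta> * x t) (at t within I) \<and>
     (y has_real_derivative - (x t - 1 / 2 * y t * \<bar>y t\<bar> - 2 * \<eta> * y t)) (at t within I))"

lemma xy_flowD: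
  assumes "xy_flow \<eta> I x y" "t \<in> I"
  shows "(x has_real_derivative y t - x t * \<bar>y t\<bar> - 2 * \<eta> * x t) (at t within I)"
    and "(y has_real_derivative - (x t - 1 / 2 * y t * \<bar>y t\<bar> - 2 * \<eta> * y t)) (at t within I)"
  using assms by (auto simp: xy_flow_def)

lemma xy_flow_subset: "xy_flow \<eta> I x y \<Longrightarrow> J \<subseteq> I \<Longrightarrow> xy_flow \<eta> J x y"
  by (auto simp: xy_flow_def intro: DERIV_subset)

lemma xy_flow_cong:
  assumes "xy_flow \<eta> I x y" "\<And>t. t \<in> I \<Longrightarrow> x t = x' t" "\<And>t. t \<in> I \<Longrightarrow> y t = y' t"
  shows "xy_flow \<eta> I x' y'"
  unfolding xy_flow_def
proof (intro ballI conjI)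
  fix t assume t: "t \<in> I"
  show "(x' has_real_derivative y' t - x' t * \<bar>y' t\<bar> - 2 * \<eta> * x' t) (at t within I)"
    by (rule has_field_derivative_transform_within[OF _ zero_less_one t, of x])
       (use xy_flowD(1)[OF assms(1) t] assms t in auto)
  show "(y' has_real_derivative - (x' t - 1 / 2 * y' t * \<bar>y' t\<bar> - 2 * \<eta> * y' t)) (at t within I)"
    by (rule has_field_derivative_transform_within[OF _ zero_less_one t, of y])
       (use xy_flowD(2)[OF assms(1) t] assms t in auto)
qed

text \<open>The vector field is odd. This pairs the solutions with \<open>y 0 > 0\<close> with those
  with \<open>y 0 < 0\<close>.\<close>

lemma xy_flow_minus: "xy_flow \<eta> I x y \<Longrightarrow> xy_flow \<eta> I (\<lambda>t. - x t) (\<lambda>t. - y t)"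
  unfolding xy_flow_def by (fastforce intro!: derivative_eq_intros)

lemma xy_flow_continuous:
  assumes "xy_flow \<eta> I x y"
  shows "continuous_on I x" "continuous_on I y"
  using assms by (auto simp: xy_flow_def intro!: DERIV_continuous_on)

text \<open>The expression inside the absolute value is the time derivative of the squared distance
  between two trajectories. The cross terms \<open>2 * p * q\<close> cancel, the terms with \<eta>
  give \<open>4 * \<eta>\<close>, and the differences of \<open>x * \<bar>y\<bar>\<close> and
  \<open>y * \<bar>y\<bar>\<close> are split by a mixed product; \<open>2 * \<bar>p\<bar> *
  \<bar>q\<bar> \<le> p\<^sup>2 + q\<^sup>2\<close> then yields \<open>3 * M\<close>.\<close>

lemma xy_field_lipschitz:
  fixes x\<^sub>1 x\<^sub>2 y\<^sub>1 y\<^sub>2 :: real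
  assumes "0 \<le> \<eta>" and M: "\<bar>x\<^sub>1\<bar> \<le> M" "\<bar>x\<^sub>2\<bar> \<le> M" "\<bar>y\<^sub>1\<bar> \<le> M" "\<bar>y\<^sub>2\<bar> \<le> M"
  shows "\<bar>2 * (x\<^sub>1 - x\<^sub>2) * ((y\<^sub>1 - x\<^sub>1 * \<bar>y\<^sub>1\<bar> - 2 * \<eta> * x\<^sub>1) - (y\<^sub>2 - x\<^sub>2 * \<bar>y\<^sub>2\<bar> - 2 * \<eta> * x\<^sub>2))
      + 2 * (y\<^sub>1 - y\<^sub>2) * (- (x\<^sub>1 - 1 / 2 * y\<^sub>1 * \<bar>y\<^sub>1\<bar> - 2 * \<eta> * y\<^sub>1)
          - - (x\<^sub>2 - 1 / 2 * y\<^sub>2 * \<bar>y\<^sub>2\<bar> - 2 * \<eta> * y\<^sub>2))\<bar>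
    \<le> (3 * M + 4 * \<eta>) * ((x\<^sub>1 - x\<^sub>2)\<^sup>2 + (y\<^sub>1 - y\<^sub>2)\<^sup>2)"
proof -
  define p q where "p = x\<^sub>1 - x\<^sub>2" and "q = y\<^sub>1 - y\<^sub>2"
  define u v where "u = x\<^sub>1 * \<bar>y\<^sub>1\<bar> - x\<^sub>2 * \<bar>y\<^sub>2\<bar>" and "v = y\<^sub>1 * \<bar>y\<^sub>1\<bar> - y\<^sub>2 * \<bar>y\<^sub>2\<bar>"
  have diff: "\<bar>\<bar>y\<^sub>1\<bar> - \<bar>y\<^sub>2\<bar>\<bar> \<le> \<bar>q\<bar>"
    unfolding q_def by (rule abs_triangle_ineq3)
  have "0 \<le> M" using M by linarith
  have "u = p * \<bar>y\<^sub>1\<bar> + x\<^sub>2 * (\<bar>y\<^sub>1\<bar> - \<bar>y\<^sub>2\<bar>)"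
    by (simp add: u_def p_def algebra_simps)
  then have "\<bar>u\<bar> \<le> \<bar>p\<bar> * \<bar>y\<^sub>1\<bar> + \<bar>x\<^sub>2\<bar> * \<bar>\<bar>y\<^sub>1\<bar> - \<bar>y\<^sub>2\<bar>\<bar>"
    by (metis abs_abs abs_mult abs_triangle_ineq)
  also have "\<dots> \<le> \<bar>p\<bar> * M + M * \<bar>q\<bar>"
    using M diff \<open>0 \<le> M\<close> by (intro add_mono mult_mono) auto
  finally have u: "\<bar>u\<bar> \<le> \<bar>p\<bar> * M + M * \<bar>q\<bar>" .
  have "v = q * \<bar>y\<^sub>1\<bar> + y\<^sub>2 * (\<bar>y\<^sub>1\<bar> - \<bar>y\<^sub>2\<bar>)"
    by (simp add: v_def q_def algebra_simps)
  then have "\<bar>v\<bar> \<le> \<bar>q\<bar> * \<bar>y\<^sub>1\<bar> + \<bar>y\<^sub>2\<bar> * \<bar>\<bar>y\<^sub>1\<bar> - \<bar>y\<^sub>2\<bar>\<bar>"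
    by (metis abs_abs abs_mult abs_triangle_ineq)
  also have "\<dots> \<le> \<bar>q\<bar> * M + M * \<bar>q\<bar>"
    using M diff \<open>0 \<le> M\<close> by (intro add_mono mult_mono) auto
  finally have v: "\<bar>v\<bar> \<le> 2 * M * \<bar>q\<bar>" by simp
  have "\<bar>p * u\<bar> \<le> \<bar>p\<bar> * (\<bar>p\<bar> * M + M * \<bar>q\<bar>)"
    using u by (simp add: abs_mult mult_left_mono)
  then have pu: "\<bar>p * u\<bar> \<le> M * p\<^sup>2 + M * \<bar>p\<bar> * \<bar>q\<bar>"
    by (simp add: algebra_simps power2_eq_square flip: abs_mult)
  have "\<bar>q * v\<bar> \<le> \<bar>q\<bar> * (2 * M * \<bar>q\<bar>)"
    using v by (simp add: abs_mult mult_left_mono)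
  then have qv: "\<bar>q * v\<bar> \<le> 2 * M * q\<^sup>2"
    by (simp add: algebra_simps power2_eq_square flip: abs_mult)
  have "0 \<le> M * (\<bar>p\<bar> - \<bar>q\<bar>)\<^sup>2" using \<open>0 \<le> M\<close> by simp
  then have pq: "2 * (M * \<bar>p\<bar> * \<bar>q\<bar>) \<le> M * p\<^sup>2 + M * q\<^sup>2"
    by (simp add: algebra_simps power2_eq_square flip: abs_mult)
  have eq: "2 * p * ((y\<^sub>1 - x\<^sub>1 * \<bar>y\<^sub>1\<bar> - 2 * \<eta> * x\<^sub>1) - (y\<^sub>2 - x\<^sub>2 * \<bar>y\<^sub>2\<bar> - 2 * \<eta> * x\<^sub>2))
      + 2 * q * (- (x\<^sub>1 - 1 / 2 * y\<^sub>1 * \<bar>y\<^sub>1\<bar> - 2 * \<eta> * y\<^sub>1)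
          - - (x\<^sub>2 - 1 / 2 * y\<^sub>2 * \<bar>y\<^sub>2\<bar> - 2 * \<eta> * y\<^sub>2))
      = - 2 * (p * u) - 4 * (\<eta> * p\<^sup>2) + q * v + 4 * (\<eta> * q\<^sup>2)"
    by (simp add: p_def q_def u_def v_def algebra_simps power2_eq_square)
  have "0 \<le> \<eta> * p\<^sup>2" "0 \<le> \<eta> * q\<^sup>2" "0 \<le> M * p\<^sup>2" "0 \<le> M * q\<^sup>2"
    using \<open>0 \<le> \<eta>\<close> \<open>0 \<le> M\<close> by auto
  then have "\<bar>- 2 * (p * u) - 4 * (\<eta> * p\<^sup>2) + q * v + 4 * (\<eta> * q\<^sup>2)\<bar>
      \<le> 3 * (M * p\<^sup>2) + 3 * (M * q\<^sup>2) + 4 * (\<eta> * p\<^sup>2) + 4 * (\<eta> * q\<^sup>2)"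
    using pu qv pq by (simp only: abs_le_iff) linarith
  then show ?thesis
    unfolding eq[unfolded p_def q_def] by (simp add: p_def q_def algebra_simps)
qed

lemma xy_flow_distance:
  assumes "0 \<le> \<eta>" "a \<le> b"
    and f1: "xy_flow \<eta> {a..b} x\<^sub>1 y\<^sub>1" and f2: "xy_flow \<eta> {a..b} x\<^sub>2 y\<^sub>2"
    and M: "\<And>t. t \<in> {a..b} \<Longrightarrow> \<bar>x\<^sub>1 t\<bar> \<le> M \<and> \<bar>x\<^sub>2 t\<bar> \<le> M \<and> \<bar>y\<^sub>1 t\<bar> \<le> M \<and> \<bar>y\<^sub>2 t\<bar> \<le> M"
  defines "D \<equiv> \<lambda>t. (x\<^sub>1 t - x\<^sub>2 t)\<^sup>2 + (y\<^sub>1 t - y\<^sub>2 t)\<^sup>2"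
  shows "D b \<le> D a * exp ((3 * M + 4 * \<eta>) * (b - a))"
    and "D a \<le> D b * exp ((3 * M + 4 * \<eta>) * (b - a))"
proof -
  define D' where "D' = (\<lambda>t. 2 * (x\<^sub>1 t - x\<^sub>2 t) * ((y\<^sub>1 t - x\<^sub>1 t * \<bar>y\<^sub>1 t\<bar> - 2 * \<eta> * x\<^sub>1 t)
        - (y\<^sub>2 t - x\<^sub>2 t * \<bar>y\<^sub>2 t\<bar> - 2 * \<eta> * x\<^sub>2 t))
      + 2 * (y\<^sub>1 t - y\<^sub>2 t) * (- (x\<^sub>1 t - 1 / 2 * y\<^sub>1 t * \<bar>y\<^sub>1 t\<bar> - 2 * \<eta> * y\<^sub>1 t)
        - - (x\<^sub>2 t - 1 / 2 * y\<^sub>2 t * \<bar>y\<^sub>2 t\<bar> - 2 * \<eta> * y\<^sub>2 t)))"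
  have der: "(D has_real_derivative D' t) (at t within {a..b})" if "t \<in> {a..b}" for t
    unfolding D_def D'_def
    by (rule derivative_eq_intros xy_flowD[OF f1 that] xy_flowD[OF f2 that] refl)+
       (simp add: field_simps)
  have bound: "\<bar>D' t\<bar> \<le> (3 * M + 4 * \<eta>) * D t" if "t \<in> {a..b}" for t
    unfolding D_def D'_def using M[OF that] \<open>0 \<le> \<eta>\<close> by (intro xy_field_lipschitz) auto
  show "D b \<le> D a * exp ((3 * M + 4 * \<eta>) * (b - a))"
    "D a \<le> D b * exp ((3 * M + 4 * \<eta>) * (b - a))"
    using gronwall_abs[of a b D D' "3 * M + 4 * \<eta>", OF der bound \<open>a \<le> b\<close>] by auto
qed

lemma xy_flow_bounded:
  assumes "xy_flow \<eta> {a..b} x y"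
  obtains M where "\<And>t. t \<in> {a..b} \<Longrightarrow> \<bar>x t\<bar> \<le> M \<and> \<bar>y t\<bar> \<le> M"
proof -
  have "bounded (x ` {a..b})" "bounded (y ` {a..b})"
    using xy_flow_continuous[OF assms]
    by (auto intro!: compact_imp_bounded compact_continuous_image)
  then obtain M\<^sub>1 M\<^sub>2 where "\<And>t. t \<in> {a..b} \<Longrightarrow> \<bar>x t\<bar> \<le> M\<^sub>1" "\<And>t. t \<in> {a..b} \<Longrightarrow> \<bar>y t\<bar> \<le> M\<^sub>2"
    unfolding bounded_iff by fastforce
  then show ?thesis
    by (intro that[of "max M\<^sub>1 M\<^sub>2"]) (auto simp: le_max_iff_disj)
qed

lemma xy_flow_unique:
  assumes "0 \<le> \<eta>"
    and f1: "xy_flow \<eta> {a..b} x\<^sub>1 y\<^sub>1" and f2: "xy_flow \<eta> {a..b} x\<^sub>2 y\<^sub>2"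
    and s: "s \<in> {a..b}" "x\<^sub>1 s = x\<^sub>2 s" "y\<^sub>1 s = y\<^sub>2 s" and t: "t \<in> {a..b}"
  shows "x\<^sub>1 t = x\<^sub>2 t \<and> y\<^sub>1 t = y\<^sub>2 t"
proof -
  obtain M\<^sub>1 where M1: "\<And>t. t \<in> {a..b} \<Longrightarrow> \<bar>x\<^sub>1 t\<bar> \<le> M\<^sub>1 \<and> \<bar>y\<^sub>1 t\<bar> \<le> M\<^sub>1"
    using xy_flow_bounded[OF f1] by metis
  obtain M\<^sub>2 where M2: "\<And>t. t \<in> {a..b} \<Longrightarrow> \<bar>x\<^sub>2 t\<bar> \<le> M\<^sub>2 \<and> \<bar>y\<^sub>2 t\<bar> \<le> M\<^sub>2"
    using xy_flow_bounded[OF f2] by metis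
  define M where "M = max M\<^sub>1 M\<^sub>2"
  have M: "\<bar>x\<^sub>1 t\<bar> \<le> M \<and> \<bar>x\<^sub>2 t\<bar> \<le> M \<and> \<bar>y\<^sub>1 t\<bar> \<le> M \<and> \<bar>y\<^sub>2 t\<bar> \<le> M" if "t \<in> {a..b}" for t
    using M1[OF that] M2[OF that] by (auto simp: M_def le_max_iff_disj)
  \<comment> \<open>The distance vanishes at \<open>s\<close>. Gronwall's inequality is applied
    between \<open>s\<close> and \<open>t\<close>, forward or backward in time according to their
    order.\<close>
  define c d where "c = min s t" and "d = max s t"
  have "c \<le> d" and sub: "{c..d} \<subseteq> {a..b}"
    using s t by (auto simp: c_def d_def)
  note dist = xy_flow_distance[OF assms(1) \<open>c \<le> d\<close> xy_flow_subset[OF f1 sub] xy_flow_subset[OF f2 sub] M]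
  have "(x\<^sub>1 t - x\<^sub>2 t)\<^sup>2 + (y\<^sub>1 t - y\<^sub>2 t)\<^sup>2 \<le> 0"
  proof (cases "s \<le> t")
    case True
    then have "c = s" "d = t" by (auto simp: c_def d_def)
    then show ?thesis using dist(1) s sub by auto
  next
    case False
    then have "c = t" "d = s" by (auto simp: c_def d_def)
    then show ?thesis using dist(2) s sub by auto
  qed
  then have "(x\<^sub>1 t - x\<^sub>2 t)\<^sup>2 + (y\<^sub>1 t - y\<^sub>2 t)\<^sup>2 = 0"
    by (intro antisym) auto
  then show ?thesis by (simp add: sum_power2_eq_zero_iff)
qed

text \<open>The system is Hamiltonian; up to a factor 2 this is its Hamiltonian.\<close>

definition xy_energy :: "real \<Rightarrow> real \<Rightarrow> real \<Rightarrow> real" where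
  "xy_energy \<eta> x y = x\<^sup>2 + y\<^sup>2 - 4 * \<eta> * x * y - x * (y * \<bar>y\<bar>)"

text \<open>The velocity of \<open>x\<close> is half the \<open>y\<close>-derivative of the energy,
  and that of \<open>y\<close> is minus half its \<open>x\<close>-derivative.\<close>

lemma xy_energy_conserved:
  assumes flow: "xy_flow \<eta> {a..b} x y" and "s \<in> {a..b}" "t \<in> {a..b}"
  shows "xy_energy \<eta> (x s) (y s) = xy_energy \<eta> (x t) (y t)"
proof -
  have "((\<lambda>t. xy_energy \<eta> (x t) (y t)) has_real_derivative 0) (at t within {a..b})"
    if "t \<in> {a..b}" for t
    unfolding xy_energy_def
    by (rule derivative_eq_intros xy_flowD[OF flow that] refl)+
       (simp add: algebra_simps power2_eq_square)
  then obtain c where "\<And>t. t \<in> {a..b} \<Longrightarrow> xy_energy \<eta> (x t) (y t) = c"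
    using has_field_derivative_zero_constant[of "{a..b}" "\<lambda>t. xy_energy \<eta> (x t) (y t)"] by auto
  then show ?thesis using assms by simp
qed

section \<open>Rays that must be crossed before the \<open>x\<close>-axis is reached\<close>

text \<open>Up to the first zero of \<open>y\<close> both coordinates are nonnegative, and at that
  zero \<open>x\<close> is positive because the energy is; so \<open>x - m * y\<close> changes sign
  on the way. Solutions are later excluded by exhibiting a ray on which the energy is too
  small.\<close>

lemma xy_flow_crosses_ray:
  assumes flow: "xy_flow \<eta> {0..T} x y" and "0 < T" and "x 0 = 0" "0 < y 0" "y T = 0" and "0 < m"
  obtains t where "t \<in> {0..T}" "0 < y t" "x t = m * y t"
proof -
  have cont: "continuous_on {0..T} x" "continuous_on {0..T} y"
    using xy_flow_continuous[OF flow] by auto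
  define Z where "Z = {t \<in> {0..T}. y t = 0}"
  have "closed Z"
    using continuous_closed_preimage_constant[OF cont(2)] by (simp add: Z_def)
  moreover have "Z \<noteq> {}" "bdd_below Z"
    using \<open>y T = 0\<close> \<open>0 < T\<close> by (auto simp: Z_def bdd_below_def)
  ultimately have "Inf Z \<in> Z" by (intro closed_contains_Inf)
  define t\<^sub>1 where "t\<^sub>1 = Inf Z"
  have t1: "t\<^sub>1 \<in> {0..T}" "y t\<^sub>1 = 0"
    using \<open>Inf Z \<in> Z\<close> by (auto simp: Z_def t\<^sub>1_def)
  have sub: "{0..t\<^sub>1} \<subseteq> {0..T}" using t1 by auto
  have ynz: "y t \<noteq> 0" if "t \<in> {0..<t\<^sub>1}" for t
    using that t1 cInf_lower[OF _ \<open>bdd_below Z\<close>, of t] by (auto simp: Z_def t\<^sub>1_def)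
  have ypos: "0 < y t" if t: "t \<in> {0..<t\<^sub>1}" for t
  proof (rule ccontr)
    assume "\<not> 0 < y t"
    then obtain s where "0 \<le> s" "s \<le> t" "y s = 0"
      using IVT2'[of y t 0 0] t less_imp_le[OF \<open>0 < y 0\<close>]
        continuous_on_subset[OF cont(2), of "{0..t}"] t1
      by (auto simp: not_less)
    then show False using ynz[of s] t by auto
  qed
  have "0 < t\<^sub>1" using t1 \<open>0 < y 0\<close> by (cases "t\<^sub>1 = 0") auto
  obtain M where M: "\<And>t. t \<in> {0..T} \<Longrightarrow> \<bar>x t\<bar> \<le> M \<and> \<bar>y t\<bar> \<le> M"
    using xy_flow_bounded[OF flow] by metis
  have xnn: "0 \<le> x t" if "t \<in> {0..t\<^sub>1}" for t
  proof (rule ccontr)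
    assume "\<not> 0 \<le> x t"
    define S where "S = {s \<in> {0..t}. x s = 0}"
    have subt: "{0..t} \<subseteq> {0..T}" using that t1 by auto
    have cx: "continuous_on {0..t} x" using cont(1) subt by (rule continuous_on_subset)
    have "closed S"
      using continuous_closed_preimage_constant[OF cx] by (simp add: S_def)
    moreover have "S \<noteq> {}" "bdd_above S"
      using \<open>x 0 = 0\<close> that by (auto simp: S_def bdd_above_def)
    ultimately have "Sup S \<in> S" by (intro closed_contains_Sup)
    define s where "s = Sup S"
    have s: "s \<in> {0..t}" "x s = 0" using \<open>Sup S \<in> S\<close> by (auto simp: S_def s_def)
    have neg: "x r < 0" if r: "r \<in> {s<..t}" for r
    proof (rule ccontr)
      assume "\<not> x r < 0"
      then obtain q where "r \<le> q" "q \<le> t" "x q = 0"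
        using IVT2'[of x t 0 r] r s \<open>\<not> 0 \<le> x t\<close> continuous_on_subset[OF cx, of "{r..t}"]
        by (auto simp: not_less)
      then have "q \<in> S" using r s by (auto simp: S_def)
      then show False using \<open>r \<le> q\<close> r cSup_upper[OF _ \<open>bdd_above S\<close>, of q] by (auto simp: s_def)
    qed
    have nonpos: "x r \<le> 0" if "r \<in> {s..t}" for r
      using neg[of r] s that by (cases "r = s") auto
    \<comment> \<open>\<open>s\<close> is the last zero of \<open>x\<close> before \<open>t\<close>.
      The exponential factor absorbs the term \<open>- 2 * \<eta> * x\<close>, and what remains of
      the derivative is nonnegative where \<open>x \<le> 0 \<le> y\<close>.\<close>
    have "x s * exp ((2 * \<eta>) * s) \<le> x t * exp ((2 * \<eta>) * t)"
    proof (rule deriv_nonneg_imp_le[where f = "\<lambda>r. x r * exp ((2 * \<eta>) * r)"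
          and f' = "\<lambda>r. (y r - x r * \<bar>y r\<bar>) * exp ((2 * \<eta>) * r)"])
      fix r assume r: "r \<in> {s..t}"
      have "(x has_real_derivative y r - x r * \<bar>y r\<bar> - 2 * \<eta> * x r) (at r within {s..t})"
        using xy_flowD(1)[OF flow, of r] r s subt by (auto intro: DERIV_subset)
      then show "((\<lambda>r. x r * exp ((2 * \<eta>) * r)) has_real_derivative
          (y r - x r * \<bar>y r\<bar>) * exp ((2 * \<eta>) * r)) (at r within {s..t})"
        by (auto intro!: derivative_eq_intros simp: algebra_simps)
      have "0 \<le> y r" using ypos[of r] t1 r s that by (cases "r = t\<^sub>1") auto
      moreover have "x r * \<bar>y r\<bar> \<le> 0" using nonpos[OF r] by (simp add: mult_nonpos_nonneg)
      ultimately show "0 \<le> (y r - x r * \<bar>y r\<bar>) * exp ((2 * \<eta>) * r)" by simp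
    qed (use s in auto)
    then show False using s \<open>\<not> 0 \<le> x t\<close> by (simp add: zero_le_mult_iff)
  qed
  \<comment> \<open>The energy is \<open>(x t\<^sub>1)\<^sup>2\<close> at \<open>t\<^sub>1\<close>
    and \<open>(y 0)\<^sup>2\<close> at time \<open>0\<close>.\<close>
  have "xy_energy \<eta> (x t\<^sub>1) (y t\<^sub>1) = xy_energy \<eta> (x 0) (y 0)"
    using xy_energy_conserved[OF flow, of t\<^sub>1 0] t1 \<open>0 < T\<close> by auto
  then have "x t\<^sub>1 \<noteq> 0"
    using t1 \<open>x 0 = 0\<close> \<open>0 < y 0\<close> by (auto simp: xy_energy_def)
  then have "0 < x t\<^sub>1" using xnn[of t\<^sub>1] \<open>0 < t\<^sub>1\<close> by auto
  moreover have "continuous_on {0..t\<^sub>1} (\<lambda>t. x t - m * y t)"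
    using cont sub by (auto intro!: continuous_intros intro: continuous_on_subset)
  moreover have "x 0 - m * y 0 \<le> 0" using \<open>x 0 = 0\<close> \<open>0 < y 0\<close> \<open>0 < m\<close> by simp
  ultimately obtain t where t: "0 \<le> t" "t \<le> t\<^sub>1" "x t - m * y t = 0"
    using IVT'[of "\<lambda>t. x t - m * y t" 0 0 t\<^sub>1] t1 \<open>0 < t\<^sub>1\<close> by auto
  then have "t \<noteq> t\<^sub>1" using t1 \<open>0 < x t\<^sub>1\<close> by auto
  then show ?thesis using that[of t] t ypos[of t] t1 by auto
qed

section \<open>The inverse of \<open>w * sqrt (1 - w)\<close> and the growth of the slowness\<close>

text \<open>The energy level \<open>\<rho>\<^sup>2 (1 - \<rho> P) = a\<^sup>2\<close> says that \<open>w = \<rho> P\<close> solves \<open>w \<surd>(1 - w) = a P\<close>;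
  the orbits that reach the \<open>x\<close>-axis stay on the branch \<open>w \<le> 2/3\<close> of its solutions.
  \<open>slowness\<close> is the function \<open>G\<close> above.\<close>

definition amplitude :: "real \<Rightarrow> real" where
  "amplitude w = w * sqrt (1 - w)"

definition branch :: "real \<Rightarrow> real" where
  "branch = the_inv_into {..2/3} amplitude"

definition slowness :: "real \<Rightarrow> real" where
  "slowness z = 1 / (1 - 3/2 * branch z)"

lemma amplitude_deriv:
  assumes "w < 1"
  shows "(amplitude has_real_derivative (1 - 3/2 * w) / sqrt (1 - w)) (at w)"
proof -
  have "sqrt (1 - w) * sqrt (1 - w) = 1 - w" using assms by simp
  then show ?thesis
    unfolding amplitude_def [abs_def] using assms
    by (auto intro!: derivative_eq_intros simp: field_simps)
qed

lemma continuous_on_amplitude: "continuous_on S amplitude"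
  unfolding amplitude_def [abs_def] by (intro continuous_intros)

text \<open>The derivative \<open>(1 - 3/2 * w) / sqrt (1 - w)\<close> changes sign at
  \<open>2/3\<close>, which is therefore the end of the branch.\<close>

lemma amplitude_strict_mono: "u < v \<Longrightarrow> v \<le> 2/3 \<Longrightarrow> amplitude u < amplitude v"
proof (rule DERIV_pos_imp_increasing_open[of u v amplitude])
  fix w assume "u < w" "w < v" "v \<le> 2/3"
  then show "\<exists>d. (amplitude has_real_derivative d) (at w) \<and> 0 < d"
    by (intro exI[of _ "(1 - 3/2 * w) / sqrt (1 - w)"] conjI amplitude_deriv) auto
qed (auto simp: continuous_on_amplitude)

lemma inj_on_amplitude: "inj_on amplitude {..2/3}"
  by (rule linorder_inj_onI') (use amplitude_strict_mono in force)

lemma amplitude_image: "amplitude ` {..2/3} = {..amplitude (2/3)}"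
proof (intro equalityI subsetI)
  fix z assume "z \<in> amplitude ` {..2/3}"
  then obtain x where "x \<le> 2/3" "z = amplitude x" by auto
  then show "z \<in> {..amplitude (2/3)}"
    using amplitude_strict_mono[of x "2/3"] by (cases "x = 2/3") auto
next
  fix z assume z: "z \<in> {..amplitude (2/3)}"
  \<comment> \<open>Left end point for the intermediate value theorem: as \<open>u \<le> 0\<close>,
    the root is at least \<open>1\<close>, so \<open>amplitude u \<le> u \<le> z\<close>.\<close>
  define u where "u = min z 0"
  have "1 \<le> sqrt (1 - u)" by (simp add: u_def)
  then have "u * sqrt (1 - u) \<le> u * 1" by (intro mult_left_mono_neg) (auto simp: u_def)
  then have "amplitude u \<le> z" by (simp add: amplitude_def u_def min_def split: if_splits)
  moreover have "u \<le> 2/3" by (simp add: u_def min_def)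
  ultimately obtain w where "u \<le> w" "w \<le> 2/3" "amplitude w = z"
    using IVT'[of amplitude u z "2/3"] z continuous_on_amplitude by auto
  then show "z \<in> amplitude ` {..2/3}" by auto
qed

lemma branch_amplitude: "w \<le> 2/3 \<Longrightarrow> branch (amplitude w) = w"
  unfolding branch_def by (rule the_inv_into_f_f[OF inj_on_amplitude]) auto

lemma amplitude_branch: "z \<le> amplitude (2/3) \<Longrightarrow> amplitude (branch z) = z"
  unfolding branch_def by (rule f_the_inv_into_f[OF inj_on_amplitude]) (simp add: amplitude_image)

lemma branch_le: "z \<le> amplitude (2/3) \<Longrightarrow> branch z \<le> 2/3"
  using the_inv_into_into[OF inj_on_amplitude, of z "{..2/3}"] by (simp add: amplitude_image branch_def)

lemma branch_less: "z < amplitude (2/3) \<Longrightarrow> branch z < 2/3"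
  using branch_le[of z] amplitude_branch[of z] by (metis less_eq_real_def less_irrefl)

lemma branch_0: "branch 0 = 0"
  using branch_amplitude[of 0] by (simp add: amplitude_def)

lemma amplitude_pos: "0 < amplitude (2/3)"
  by (simp add: amplitude_def)

lemma branch_mono: "y \<le> z \<Longrightarrow> z \<le> amplitude (2/3) \<Longrightarrow> branch y \<le> branch z"
  using amplitude_strict_mono[of "branch z" "branch y"] branch_le[of y] amplitude_branch[of y] amplitude_branch[of z]
  by force

lemma branch_deriv:
  assumes z: "z < amplitude (2/3)"
  shows "(branch has_real_derivative sqrt (1 - branch z) / (1 - 3/2 * branch z)) (at z)"
proof -
  define w where "w = branch z"
  have w: "w < 2/3" "amplitude w = z"
    using branch_less[OF z] amplitude_branch[of z] z by (auto simp: w_def)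
  have "isCont branch (amplitude w)"
  \<comment> \<open>A neighbourhood of \<open>w\<close> that stays below \<open>2/3\<close>; its
    right end is the midpoint of \<open>w\<close> and \<open>2/3\<close>.\<close>
  proof (rule isCont_inverse_function2[of "w - 1" w "(w + 2/3) / 2"])
    fix v :: real assume "w - 1 \<le> v" "v \<le> (w + 2/3) / 2"
    then show "branch (amplitude v) = v" "isCont amplitude v"
      using w branch_amplitude[of v] continuous_on_amplitude[of UNIV]
      by (auto simp: continuous_on_eq_continuous_at)
  qed (use w in auto)
  then have "(branch has_real_derivative inverse ((1 - 3/2 * w) / sqrt (1 - w))) (at z)"
    using z w amplitude_deriv[of w]
    by (intro DERIV_inverse_function[where f = amplitude and a = "z - 1" and b = "amplitude (2/3)"])
       (auto simp: amplitude_branch simp flip: w_def)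
  then show ?thesis by (simp add: w_def)
qed

lemma slowness_pos: "z < amplitude (2/3) \<Longrightarrow> 0 < slowness z"
  using branch_less[of z] by (simp add: slowness_def)

lemma slowness_mono:
  assumes "y \<le> z" "z < amplitude (2/3)"
  shows "slowness y \<le> slowness z"
proof -
  have "1 - 3/2 * branch z \<le> 1 - 3/2 * branch y" "0 < 1 - 3/2 * branch z"
    using branch_mono[of y z] branch_less[of z] assms by auto
  then show ?thesis unfolding slowness_def by (intro divide_left_mono) auto
qed

lemma continuous_on_slowness: "continuous_on {..<amplitude (2/3)} slowness"
proof -
  have "continuous_on {..<amplitude (2/3)} branch"
    by (rule DERIV_continuous_on[OF has_field_derivative_at_within[OF branch_deriv]]) simp
  then show ?thesis
    unfolding slowness_def [abs_def] using branch_less by (intro continuous_intros) force+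
qed

text \<open>Under the substitution \<open>z = amplitude w\<close> this function is
  \<open>slowness z - 3/2 * z\<close>, the slowness minus its linear part at the origin.\<close>

lemma slowness_amplitude_deriv:
  assumes "w < 2/3"
  shows "((\<lambda>w. 1 / (1 - 3/2 * w) - 3/2 * amplitude w) has_real_derivative
    3/2 * (1 / (1 - 3/2 * w)\<^sup>2 - (1 - 3/2 * w) / sqrt (1 - w))) (at w)"
  using assms
  by (auto intro!: derivative_eq_intros amplitude_deriv simp: field_simps power2_eq_square)

text \<open>The bracket has the sign of \<open>e - d ^ 3\<close>, and
  \<open>d\<^sup>2 = e\<^sup>2 - w * (2 - 9/4 * w)\<close>. Hence
  \<open>d ^ 3 \<le> d \<le> e\<close> for \<open>w \<ge> 0\<close>, where \<open>d \<le> 1\<close>,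
  and \<open>e \<le> d \<le> d ^ 3\<close> for \<open>w \<le> 0\<close>, where
  \<open>d \<ge> 1\<close>.\<close>

lemma slowness_amplitude_deriv_sign:
  assumes "w < 2/3"
  shows "0 \<le> w \<Longrightarrow> 0 \<le> 3/2 * (1 / (1 - 3/2 * w)\<^sup>2 - (1 - 3/2 * w) / sqrt (1 - w))"
    and "w \<le> 0 \<Longrightarrow> 3/2 * (1 / (1 - 3/2 * w)\<^sup>2 - (1 - 3/2 * w) / sqrt (1 - w)) \<le> 0"
proof -
  define d e where "d = 1 - 3/2 * w" and "e = sqrt (1 - w)"
  have "0 < d" "0 < e" using assms by (auto simp: d_def e_def)
  have eq: "1 / d\<^sup>2 - d / e = (e - d ^ 3) / (d\<^sup>2 * e)"
    using \<open>0 < d\<close> \<open>0 < e\<close> by (simp add: field_simps power2_eq_square power3_eq_cube)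
  have d2: "d\<^sup>2 = 1 - w - w * (2 - 9/4 * w)"
    by (simp add: d_def field_simps power2_eq_square)
  show "0 \<le> 3/2 * (1 / (1 - 3/2 * w)\<^sup>2 - (1 - 3/2 * w) / sqrt (1 - w))" if "0 \<le> w"
  proof -
    have "0 \<le> w * (2 - 9/4 * w)" using that assms by simp
    then have "d \<le> e" unfolding e_def by (intro real_le_rsqrt) (simp add: d2)
    moreover have "d ^ 3 \<le> d"
      using power_decreasing[of 1 3 d] \<open>0 < d\<close> that by (simp add: d_def)
    ultimately have "0 \<le> 1 / d\<^sup>2 - d / e" using \<open>0 < e\<close> unfolding eq by simp
    then show ?thesis unfolding d_def e_def by (intro mult_nonneg_nonneg) simp_all
  qed
  show "3/2 * (1 / (1 - 3/2 * w)\<^sup>2 - (1 - 3/2 * w) / sqrt (1 - w)) \<le> 0" if "w \<le> 0"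
  proof -
    have "w * (2 - 9/4 * w) \<le> 0" using that by (simp add: mult_nonpos_nonneg)
    then have "e \<le> d" unfolding e_def using \<open>0 < d\<close> by (intro real_le_lsqrt) (auto simp: d2)
    moreover have "d \<le> d ^ 3"
      using power_increasing[of 1 3 d] that by (simp add: d_def)
    ultimately have "1 / d\<^sup>2 - d / e \<le> 0"
      using \<open>0 < e\<close> unfolding eq by (intro divide_nonpos_nonneg) auto
    then show ?thesis unfolding d_def e_def by (intro mult_nonneg_nonpos) simp_all
  qed
qed

lemma slowness_eq:
  assumes "z < amplitude (2/3)"
  shows "slowness z - 3/2 * z = 1 / (1 - 3/2 * branch z) - 3/2 * amplitude (branch z)"
  using assms amplitude_branch[of z] by (simp add: slowness_def)

text \<open>The secant slopes of \<^term>\<open>slowness\<close> through points on the same side of the origin are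
  compared with its slope \<open>3/2\<close> at the origin.  The bound is therefore linear in \<open>p\<close>, so after
  integrating over an orbit only the integral of \<open>p\<close> matters.\<close>

lemma slowness_diff:
  assumes "0 \<le> a" "a \<le> b" "a * p < amplitude (2/3)" "b * p < amplitude (2/3)"
  shows "3/2 * (b - a) * p \<le> slowness (b * p) - slowness (a * p)"
proof -
  let ?f = "\<lambda>w. 1 / (1 - 3/2 * w) - 3/2 * amplitude w"
  have "?f (branch (a * p)) \<le> ?f (branch (b * p))"
  proof (cases "0 \<le> p")
    case True
    then have "0 \<le> branch (a * p)" "branch (a * p) \<le> branch (b * p)"
      using assms branch_mono[of 0 "a * p"] branch_mono[of "a * p" "b * p"]
      by (auto simp: branch_0 mult_right_mono)
    show ?thesis
    proof (rule DERIV_nonneg_imp_nondecreasing[of "branch (a * p)" "branch (b * p)" ?f])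
      fix w assume "branch (a * p) \<le> w" "w \<le> branch (b * p)"
      then have "w < 2/3" "0 \<le> w"
        using branch_less[OF assms(4)] \<open>0 \<le> branch (a * p)\<close> by linarith+
      then show "\<exists>d. (?f has_real_derivative d) (at w) \<and> 0 \<le> d"
        using slowness_amplitude_deriv slowness_amplitude_deriv_sign(1) by blast
    qed fact
  next
    case False
    \<comment> \<open>For negative \<open>p\<close> the order of the two arguments is reversed, but
      left of the origin the function is nonincreasing, so the inequality keeps its
      direction.\<close>
    then have "a * p \<le> 0" "b * p \<le> a * p"
      using assms(1,2) by (auto intro: mult_nonneg_nonpos mult_right_mono_neg)
    then have "branch (a * p) \<le> 0" "branch (b * p) \<le> branch (a * p)"
      using assms(3) amplitude_pos branch_mono[of "a * p" 0] branch_mono[of "b * p" "a * p"]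
      by (simp_all add: branch_0)
    show ?thesis
    proof (rule DERIV_nonpos_imp_nonincreasing[of "branch (b * p)" "branch (a * p)" ?f])
      fix w assume "branch (b * p) \<le> w" "w \<le> branch (a * p)"
      then have "w < 2/3" "w \<le> 0"
        using \<open>branch (a * p) \<le> 0\<close> by linarith+
      then show "\<exists>d. (?f has_real_derivative d) (at w) \<and> d \<le> 0"
        using slowness_amplitude_deriv slowness_amplitude_deriv_sign(2) by blast
    qed fact
  qed
  moreover have "3/2 * (b - a) * p = 3/2 * (b * p) - 3/2 * (a * p)" by (simp add: field_simps)
  ultimately show ?thesis
    using slowness_eq[OF assms(3)] slowness_eq[OF assms(4)] by linarith
qed

section \<open>Elliptic polar coordinates and the saddle point for \<eta> < 1/2\<close>

locale subcritical =
  fixes \<eta> :: real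
  assumes eta_nonneg: "0 \<le> \<eta>" and eta_less: "\<eta> < 1/2"
begin

text \<open>The frequency of the linearisation at the origin; its square is the determinant of the
  quadratic form \<open>x\<^sup>2 + y\<^sup>2 - 4 * \<eta> * x * y\<close>.\<close>

definition \<omega> :: real where "\<omega> = sqrt (1 - 4 * \<eta>\<^sup>2)"

definition \<gamma> :: real where "\<gamma> = arccos (2 * \<eta>)"

text \<open>Writing \<open>x = \<rho> sin \<beta> / \<omega>\<close> and \<open>y = \<rho> sin (\<beta> + \<gamma>) / \<omega>\<close> turns the quadratic part of the energy
  into \<open>\<rho>\<^sup>2\<close> and its cubic part into \<open>\<rho>\<^sup>3 P \<beta>\<close>.\<close>

definition P :: "real \<Rightarrow> real" where
  "P \<beta> = sin \<beta> * (sin (\<beta> + \<gamma>) * \<bar>sin (\<beta> + \<gamma>)\<bar>) / \<omega> ^ 3"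

definition P' :: "real \<Rightarrow> real" where
  "P' \<beta> = (cos \<beta> * (sin (\<beta> + \<gamma>) * \<bar>sin (\<beta> + \<gamma>)\<bar>)
     + 2 * sin \<beta> * \<bar>sin (\<beta> + \<gamma>)\<bar> * cos (\<beta> + \<gamma>)) / \<omega> ^ 3"

lemma omega_sq: "\<omega>\<^sup>2 = 1 - 4 * \<eta>\<^sup>2" and omega_pos: "0 < \<omega>"
proof -
  have "\<eta>\<^sup>2 < (1/2)\<^sup>2" using eta_nonneg eta_less by (intro power_strict_mono) auto
  then have "0 < 1 - 4 * \<eta>\<^sup>2" by (simp add: power2_eq_square)
  then show "\<omega>\<^sup>2 = 1 - 4 * \<eta>\<^sup>2" "0 < \<omega>" by (auto simp: \<omega>_def)
qed

lemma cos_gamma: "cos \<gamma> = 2 * \<eta>" and sin_gamma: "sin \<gamma> = \<omega>"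
  using eta_nonneg eta_less
  by (simp_all add: \<gamma>_def cos_arccos sin_arccos \<omega>_def power_mult_distrib)

lemma gamma_pos: "0 < \<gamma>" and gamma_less: "\<gamma> < pi"
proof -
  have "arccos 1 < \<gamma>" unfolding \<gamma>_def using eta_nonneg eta_less by (intro arccos_less_arccos) auto
  then show "0 < \<gamma>" by simp
  show "\<gamma> < pi"
    using arccos_less_arccos[of "-1" "2 * \<eta>"] eta_nonneg eta_less by (simp add: \<gamma>_def)
qed

lemma sin_shift: "sin (\<beta> + \<gamma>) = 2 * \<eta> * sin \<beta> + \<omega> * cos \<beta>"
  and cos_shift: "cos (\<beta> + \<gamma>) = 2 * \<eta> * cos \<beta> - \<omega> * sin \<beta>"
  by (simp_all add: sin_add cos_add cos_gamma sin_gamma)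

lemma P_deriv: "(P has_real_derivative P' \<beta>) (at \<beta> within S)"
  unfolding P_def [abs_def] P'_def
  using omega_pos by (auto intro!: derivative_eq_intros simp: field_simps)

lemma continuous_on_P: "continuous_on S P"
  by (rule DERIV_continuous_on[OF P_deriv])

lemma P_ge: "- (1 / \<omega> ^ 3) \<le> P \<beta>"
proof -
  have "\<bar>sin \<beta> * (sin (\<beta> + \<gamma>) * \<bar>sin (\<beta> + \<gamma>)\<bar>)\<bar> \<le> 1 * (1 * 1)"
    unfolding abs_mult by (intro mult_mono) auto
  then show ?thesis using omega_pos by (simp add: P_def field_simps abs_le_iff)
qed

text \<open>A maximum over one period exists by compactness. Its value is positive, which forces
  both \<open>sin \<beta>\<close> and \<open>sin (\<beta> + \<gamma>)\<close> to be positive and so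
  locates the maximiser strictly inside the first quadrant of the
  \<open>(x, y)\<close>-plane.\<close>

lemma P_max_exists:
  obtains \<beta> where "0 < \<beta>" "\<beta> + \<gamma> < pi" "\<And>\<alpha>. P \<alpha> \<le> P \<beta>" "0 < P \<beta>"
proof -
  obtain \<beta> where \<beta>: "\<beta> \<in> {0..pi}" "\<And>\<alpha>. \<alpha> \<in> {0..pi} \<Longrightarrow> P \<alpha> \<le> P \<beta>"
    using continuous_attains_sup[OF compact_Icc _ continuous_on_P, of 0 pi] pi_ge_zero by auto
  have max: "P \<alpha> \<le> P \<beta>" for \<alpha>
  proof -
    \<comment> \<open>\<open>P\<close> has period \<pi>: changing the sign of both cosine and sine
      moves the angle into \<open>{0..pi}\<close> and leaves \<open>P\<close> unchanged.\<close>
    define s :: real where "s = (if 0 \<le> sin \<alpha> then 1 else - 1)"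
    have "0 \<le> s * sin \<alpha>" "s\<^sup>2 = 1" by (auto simp: s_def)
    moreover from this have "(s * cos \<alpha>)\<^sup>2 + (s * sin \<alpha>)\<^sup>2 = 1"
      by (simp add: power_mult_distrib)
    ultimately obtain t where t: "0 \<le> t" "t \<le> pi" "s * cos \<alpha> = cos t" "s * sin \<alpha> = sin t"
      using sincos_total_pi by blast
    have "sin (t + \<gamma>) = s * sin (\<alpha> + \<gamma>)"
      unfolding sin_shift t(3,4)[symmetric] by (simp add: algebra_simps)
    then have "P t = (s * s * \<bar>s\<bar>) * P \<alpha>" by (simp add: P_def abs_mult flip: t(4))
    then have "P \<alpha> = P t" by (simp add: s_def)
    then show ?thesis using \<beta>(2)[of t] t by simp
  qed
  \<comment> \<open>The midpoint of the interval on which both sines are positive witnesses a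
    positive value of \<open>P\<close>.\<close>
  have "0 < sin ((pi - \<gamma>) / 2)" "0 < sin ((pi - \<gamma>) / 2 + \<gamma>)"
    using gamma_pos gamma_less by (intro sin_gt_zero; simp add: field_simps)+
  then have "0 < P ((pi - \<gamma>) / 2)"
    unfolding P_def using omega_pos by (intro divide_pos_pos mult_pos_pos) auto
  then have pos: "0 < P \<beta>" using max by (rule less_le_trans)
  then have "sin \<beta> \<noteq> 0" "0 \<le> sin \<beta>"
    using \<beta>(1) by (auto simp: P_def sin_ge_zero)
  then have "0 < sin \<beta>" by simp
  then have "\<beta> \<noteq> 0" by auto
  have "0 < sin (\<beta> + \<gamma>)"
    using pos \<open>0 < sin \<beta>\<close> omega_pos by (auto simp: P_def zero_less_mult_iff zero_less_divide_iff)
  then have "\<beta> + \<gamma> < pi"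
    using sin_le_zero[of "\<beta> + \<gamma>"] \<beta>(1) gamma_less by force
  then show ?thesis using that[of \<beta>] max pos \<beta>(1) \<open>\<beta> \<noteq> 0\<close> by auto
qed

definition \<beta>\<^sub>s :: real where
  "\<beta>\<^sub>s = (SOME \<beta>. 0 < \<beta> \<and> \<beta> + \<gamma> < pi \<and> (\<forall>\<alpha>. P \<alpha> \<le> P \<beta>) \<and> 0 < P \<beta>)"

lemma saddle_angle: "0 < \<beta>\<^sub>s" "\<beta>\<^sub>s + \<gamma> < pi" "P \<alpha> \<le> P \<beta>\<^sub>s" "0 < P \<beta>\<^sub>s"
proof -
  have "0 < \<beta>\<^sub>s \<and> \<beta>\<^sub>s + \<gamma> < pi \<and> (\<forall>\<alpha>. P \<alpha> \<le> P \<beta>\<^sub>s) \<and> 0 < P \<beta>\<^sub>s"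
    unfolding \<beta>\<^sub>s_def by (rule someI_ex) (use P_max_exists in blast)
  then show "0 < \<beta>\<^sub>s" "\<beta>\<^sub>s + \<gamma> < pi" "P \<alpha> \<le> P \<beta>\<^sub>s" "0 < P \<beta>\<^sub>s" by auto
qed

text \<open>For \<rho> > 0 the energy \<rho>^2 - \<rho>^3 \<open>P \<beta>\<close> is critical where
  the derivative of \<open>P\<close> vanishes and \<rho> \<open>P \<beta>\<close> = 2/3; this
  determines the radius.\<close>

definition saddle_x :: real where "saddle_x = 2 / (3 * P \<beta>\<^sub>s) * sin \<beta>\<^sub>s / \<omega>"
definition saddle_y :: real where "saddle_y = 2 / (3 * P \<beta>\<^sub>s) * sin (\<beta>\<^sub>s + \<gamma>) / \<omega>"

text \<open>The square of this number is the energy of the saddle. It is also the amplitude at which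
  \<open>a * P \<beta>\<close> first reaches the end of the branch at some angle.\<close>

definition a\<^sub>s :: real where "a\<^sub>s = amplitude (2/3) / P \<beta>\<^sub>s"

lemma sin_saddle_pos: "0 < sin \<beta>\<^sub>s" "0 < sin (\<beta>\<^sub>s + \<gamma>)"
  using saddle_angle(1,2) gamma_pos by (auto intro!: sin_gt_zero)

text \<open>Criticality of \<open>P\<close> becomes the quadratic relation \<open>crit\<close>
  between the two sines \<open>X\<close> and \<open>S\<close>. Together with the expression of
  \<open>\<omega>\<^sup>2\<close> in \<open>X\<close> and \<open>S\<close> it gives
  \<open>saddle_x = 1 - 2 * \<eta> * X / S\<close>, from which both equations follow by
  algebra.\<close>

lemma saddle_equilibrium: "xy_flow \<eta> I (\<lambda>_. saddle_x) (\<lambda>_. saddle_y)"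
proof -
  define X S C where "X = sin \<beta>\<^sub>s" and "S = sin (\<beta>\<^sub>s + \<gamma>)" and "C = cos \<beta>\<^sub>s"
  have pos: "0 < X" "0 < S" using sin_saddle_pos by (auto simp: X_def S_def)
  have S: "S = 2 * \<eta> * X + \<omega> * C" by (simp add: S_def X_def C_def sin_shift)
  have "P' \<beta>\<^sub>s = 0"
    using DERIV_local_max[OF P_deriv[of _ UNIV] zero_less_one] saddle_angle(3) by auto
  then have "C * (S * S) + 2 * X * S * (2 * \<eta> * C - \<omega> * X) = 0"
    using pos omega_pos by (simp add: P'_def S_def X_def C_def cos_shift)
  then have "S * (C * S + 2 * X * (2 * \<eta> * C - \<omega> * X)) = 0"
    by (simp add: algebra_simps)
  then have "C * S + 2 * X * (2 * \<eta> * C - \<omega> * X) = 0" using pos by simp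
  \<comment> \<open>The factor \<omega> allows \<open>C\<close> to be eliminated through
    \<open>\<omega> * C = S - 2 * \<eta> * X\<close>.\<close>
  then have "\<omega> * (C * S + 2 * X * (2 * \<eta> * C - \<omega> * X)) = 0" by simp
  then have "\<omega> * C * S + 2 * X * (2 * \<eta> * (\<omega> * C) - \<omega>\<^sup>2 * X) = 0"
    by (simp add: algebra_simps power2_eq_square)
  moreover have "\<omega> * C = S - 2 * \<eta> * X" using S by simp
  ultimately have "(S - 2 * \<eta> * X) * S + 2 * X * (2 * \<eta> * (S - 2 * \<eta> * X) - (1 - 4 * \<eta>\<^sup>2) * X) = 0"
    unfolding omega_sq by simp
  then have crit: "S\<^sup>2 + 2 * \<eta> * X * S - 2 * X\<^sup>2 = 0"
    by (simp add: algebra_simps power2_eq_square)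
  have "\<omega>\<^sup>2 = \<omega>\<^sup>2 * (X\<^sup>2 + C\<^sup>2)" by (simp add: X_def C_def)
  also have "\<dots> = \<omega>\<^sup>2 * X\<^sup>2 + (\<omega> * C)\<^sup>2" by (simp add: algebra_simps power_mult_distrib)
  also have "\<dots> = X\<^sup>2 + S\<^sup>2 - 4 * \<eta> * X * S"
    unfolding \<open>\<omega> * C = S - 2 * \<eta> * X\<close> omega_sq by (simp add: algebra_simps power2_eq_square)
  finally have om: "\<omega>\<^sup>2 = 3/2 * S\<^sup>2 - 3 * \<eta> * X * S" using crit by linarith
  have P: "P \<beta>\<^sub>s = X * S\<^sup>2 / \<omega> ^ 3"
    using pos by (simp add: P_def X_def S_def power2_eq_square)
  have "saddle_x = 2/3 * \<omega>\<^sup>2 / S\<^sup>2"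
    using pos omega_pos unfolding saddle_x_def P X_def[symmetric]
    by (simp add: field_simps power2_eq_square power3_eq_cube)
  then have x: "saddle_x = 1 - 2 * \<eta> * X / S"
    using pos unfolding om by (simp add: diff_divide_distrib power2_eq_square)
  have y: "saddle_y = saddle_x * S / X"
    using pos unfolding saddle_x_def saddle_y_def S_def X_def by (simp add: field_simps)
  have y0: "0 \<le> saddle_y"
    using pos saddle_angle(4) omega_pos by (simp add: saddle_y_def S_def)
  have 1: "saddle_y - saddle_x * \<bar>saddle_y\<bar> - 2 * \<eta> * saddle_x = 0"
  proof -
    have "saddle_y * (1 - saddle_x) = 2 * \<eta> * saddle_x"
      unfolding y using pos by (subst (2) x) (simp add: field_simps)
    then show ?thesis using y0 by (simp add: algebra_simps)
  qed
  have 2: "- (saddle_x - 1/2 * saddle_y * \<bar>saddle_y\<bar> - 2 * \<eta> * saddle_y) = 0"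
  proof -
    have "1/2 * saddle_x * S\<^sup>2 + 2 * \<eta> * S * X = X\<^sup>2"
    proof -
      have "saddle_x * S\<^sup>2 = S\<^sup>2 - 2 * \<eta> * X * S"
        unfolding x using pos by (simp add: field_simps power2_eq_square)
      then show ?thesis using crit by (simp add: algebra_simps)
    qed
    then have "1/2 * saddle_x * (S / X)\<^sup>2 + 2 * \<eta> * (S / X) = 1"
      using pos by (simp add: field_simps power2_eq_square)
    then have "saddle_x * (1/2 * saddle_x * (S / X)\<^sup>2 + 2 * \<eta> * (S / X)) = saddle_x * 1"
      by (simp only:)
    then show ?thesis unfolding abs_of_nonneg[OF y0] by (simp add: y algebra_simps power2_eq_square)
  qed
  show ?thesis unfolding xy_flow_def 1 2 by simp
qed

lemma saddle_x_pos: "0 < saddle_x"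
  using sin_saddle_pos saddle_angle(4) omega_pos by (simp add: saddle_x_def)

lemma a_s_pos: "0 < a\<^sub>s"
  using saddle_angle(4) amplitude_pos by (simp add: a\<^sub>s_def)

text \<open>Ensures that \<open>branch\<close> and \<open>slowness\<close> are evaluated inside
  their proper range at every angle of the orbit.\<close>

lemma below_saddle: "0 \<le> a \<Longrightarrow> a < a\<^sub>s \<Longrightarrow> a * P \<beta> < amplitude (2/3)"
proof -
  assume a: "0 \<le> a" "a < a\<^sub>s"
  have "a * P \<beta> \<le> a * P \<beta>\<^sub>s" using a saddle_angle(3) by (intro mult_left_mono)
  also have "\<dots> < amplitude (2/3)" using a saddle_angle(4) by (simp add: a\<^sub>s_def field_simps)
  finally show ?thesis .
qed

text \<open>The quadratic part reduces to the law of cosines for the sines of \<beta>, \<beta> +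
  \<gamma> and \<gamma>, with \<open>cos \<gamma> = 2 * \<eta>\<close>.\<close>

lemma xy_energy_polar:
  "xy_energy \<eta> (\<rho> * sin \<beta> / \<omega>) (\<rho> * sin (\<beta> + \<gamma>) / \<omega>) = \<rho>\<^sup>2 - \<rho>\<^sup>2 * \<bar>\<rho>\<bar> * P \<beta>"
proof -
  have "(sin \<beta>)\<^sup>2 + (sin (\<beta> + \<gamma>))\<^sup>2 - 4 * \<eta> * sin \<beta> * sin (\<beta> + \<gamma>)
      = (sin \<beta>)\<^sup>2 * (1 - 4 * \<eta>\<^sup>2) + \<omega>\<^sup>2 * (cos \<beta>)\<^sup>2"
    unfolding sin_shift by (simp add: algebra_simps power2_eq_square)
  also have "\<dots> = \<omega>\<^sup>2" unfolding omega_sq[symmetric] by (simp add: algebra_simps flip: distrib_left)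
  finally have *: "(sin \<beta>)\<^sup>2 + (sin (\<beta> + \<gamma>))\<^sup>2 - 4 * \<eta> * sin \<beta> * sin (\<beta> + \<gamma>) = \<omega>\<^sup>2" .
  have "xy_energy \<eta> (\<rho> * sin \<beta> / \<omega>) (\<rho> * sin (\<beta> + \<gamma>) / \<omega>)
      = \<rho>\<^sup>2 * ((sin \<beta>)\<^sup>2 + (sin (\<beta> + \<gamma>))\<^sup>2 - 4 * \<eta> * sin \<beta> * sin (\<beta> + \<gamma>)) / \<omega>\<^sup>2 - \<rho>\<^sup>2 * \<bar>\<rho>\<bar> * P \<beta>"
    using omega_pos
    by (simp add: xy_energy_def P_def abs_mult field_simps power2_eq_square power3_eq_cube)
  then show ?thesis unfolding * using omega_pos by simp
qed

text \<open>On the ray through the saddle the energy is at most \<open>a\<^sub>s\<^sup>2\<close>, with equality only at the saddle.\<close>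

lemma amplitude_bound:
  assumes flow: "xy_flow \<eta> {0..T} x y" and "0 < T" and "x 0 = 0" "0 < y 0" "y T = 0"
  shows "y 0 < a\<^sub>s"
proof (rule ccontr)
  assume "\<not> y 0 < a\<^sub>s"
  define m where "m = sin \<beta>\<^sub>s / sin (\<beta>\<^sub>s + \<gamma>)"
  have "0 < m" using sin_saddle_pos by (simp add: m_def)
  then obtain t where t: "t \<in> {0..T}" "0 < y t" "x t = m * y t"
    using xy_flow_crosses_ray[OF assms] by metis
  define \<rho> where "\<rho> = \<omega> * y t / sin (\<beta>\<^sub>s + \<gamma>)"
  have y: "y t = \<rho> * sin (\<beta>\<^sub>s + \<gamma>) / \<omega>" and x: "x t = \<rho> * sin \<beta>\<^sub>s / \<omega>"
    using omega_pos sin_saddle_pos t by (auto simp: \<rho>_def m_def field_simps)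
  have "0 < \<rho>" using t omega_pos sin_saddle_pos by (simp add: \<rho>_def)
  define p where "p = P \<beta>\<^sub>s"
  have "0 < p" using saddle_angle(4) by (simp add: p_def)
  have "(y 0)\<^sup>2 = xy_energy \<eta> (x 0) (y 0)" using \<open>x 0 = 0\<close> by (simp add: xy_energy_def)
  also have "\<dots> = xy_energy \<eta> (x t) (y t)"
    using xy_energy_conserved[OF flow] t \<open>0 < T\<close> by auto
  also have "\<dots> = \<rho>\<^sup>2 - \<rho>\<^sup>2 * \<rho> * p"
    unfolding x y xy_energy_polar using \<open>0 < \<rho>\<close> by (simp add: p_def)
  finally have "a\<^sub>s\<^sup>2 \<le> \<rho>\<^sup>2 - \<rho>\<^sup>2 * \<rho> * p"
    using \<open>\<not> y 0 < a\<^sub>s\<close> a_s_pos power_mono[of "a\<^sub>s" "y 0" 2] by simp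
  moreover have "a\<^sub>s\<^sup>2 = 4 / (27 * p\<^sup>2)"
    by (simp add: a\<^sub>s_def p_def amplitude_def power_divide power_mult_distrib)
  ultimately have "4 / (27 * p\<^sup>2) * p\<^sup>2 \<le> (\<rho>\<^sup>2 - \<rho>\<^sup>2 * \<rho> * p) * p\<^sup>2"
    by (intro mult_right_mono) auto
  \<comment> \<open>With \<open>r = \<rho> * p\<close> the inequality reads
    \<open>4/27 \<le> r\<^sup>2 - r ^ 3\<close>, and the cubic has the double root
    \<open>2/3\<close>. So the orbit is at the saddle at time \<open>t\<close>, and by uniqueness at
    all times.\<close>
  then have "(\<rho> * p - 2/3)\<^sup>2 * (\<rho> * p + 1/3) \<le> 0"
    using \<open>0 < p\<close> by (simp add: field_simps power2_eq_square)
  then have "(\<rho> * p - 2/3)\<^sup>2 \<le> 0"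
    using mult_pos_pos[OF \<open>0 < \<rho>\<close> \<open>0 < p\<close>] by (simp only: mult_le_0_iff) linarith
  then have "\<rho> * p = 2/3" by simp
  then have "\<rho> = 2 / (3 * P \<beta>\<^sub>s)" using \<open>0 < p\<close> by (simp add: p_def field_simps)
  then have "x t = saddle_x" "y t = saddle_y"
    using x y by (auto simp: saddle_x_def saddle_y_def)
  then have "x 0 = saddle_x"
    using xy_flow_unique[OF eta_nonneg flow saddle_equilibrium t(1), of 0] \<open>0 < T\<close> by auto
  then show False using saddle_x_pos \<open>x 0 = 0\<close> by simp
qed

end

section \<open>Transit times as integrals over the angle\<close>

text \<open>Separation of variables. The lower bound \<open>c\<close> makes \<open>F\<close> grow at
  least linearly, hence a bijection of the real line, and its inverse solves the autonomous equation
  with speed \<open>1 / g\<close> for all times.\<close>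

lemma inverse_of_antiderivative:
  fixes F g :: "real \<Rightarrow> real"
  assumes F: "\<And>u. (F has_real_derivative g u) (at u)" and g: "\<And>u. c \<le> g u" and "0 < c"
  obtains G where "\<And>t. F (G t) = t" "\<And>u. G (F u) = u"
    "\<And>t. (G has_real_derivative 1 / g (G t)) (at t)"
proof -
  have slope: "c * (v - u) \<le> F v - F u" if "u \<le> v" for u v
  proof -
    have "F u - c * u \<le> F v - c * v"
      by (rule DERIV_nonneg_imp_nondecreasing[of u v "\<lambda>u. F u - c * u"])
         (use that g in \<open>auto intro!: exI[of _ "g _ - c"] derivative_eq_intros F\<close>)
    then show ?thesis by (simp add: algebra_simps)
  qed
  have inj: "F u = F v \<Longrightarrow> u = v" for u v
    using slope[of u v] slope[of v u] mult_pos_pos[OF \<open>0 < c\<close>, of "v - u"]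
      mult_pos_pos[OF \<open>0 < c\<close>, of "u - v"]
    by (cases u v rule: linorder_cases) simp_all
  have cont: "isCont F u" for u
    using F by (rule DERIV_isCont)
  have "\<exists>u. F u = t" for t
  proof -
    define K where "K = \<bar>t - F 0\<bar> / c"
    have "0 \<le> K" "c * K = \<bar>t - F 0\<bar>" using \<open>0 < c\<close> by (auto simp: K_def)
    then have "F (- K) \<le> t" "t \<le> F K"
      using slope[of 0 K] slope[of "- K" 0] by (auto simp: abs_le_iff)
    then show ?thesis
      using IVT[of F "- K" t K] \<open>0 \<le> K\<close> cont by auto
  qed
  then obtain G where FG: "\<And>t. F (G t) = t" by metis
  have GF: "G (F u) = u" for u using inj[OF FG] .
  have "(G has_real_derivative inverse (g (G t))) (at t)" for t
  proof (rule DERIV_inverse_function[where f = F and a = "t - 1" and b = "t + 1"])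
    have "isCont G (F (G t))"
      by (rule isCont_inverse_function[where d = 1]) (auto simp: GF cont)
    then show "isCont G t" by (simp add: FG)
    show "g (G t) \<noteq> 0" using g[of "G t"] \<open>0 < c\<close> by auto
  qed (auto simp: FG intro: F)
  then show ?thesis using FG GF by (intro that[of G]) (simp_all add: inverse_eq_divide)
qed

context subcritical
begin

definition transit :: "real \<Rightarrow> real \<Rightarrow> real" where
  "transit a u = integral {0..u} (\<lambda>\<beta>. slowness (a * P \<beta>) / \<omega>)"

text \<open>The angles at which an orbit leaving the positive \<open>y\<close>-axis meets the \<open>x\<close>-axis.\<close>

definition hit :: "nat \<Rightarrow> real" where
  "hit k = (real k + 1) * pi - \<gamma>"

lemma hit_ge: "pi - \<gamma> \<le> hit k"
  by (simp add: hit_def distrib_right)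

lemma hit_pos: "0 < hit k"
  using gamma_less hit_ge[of k] by linarith

lemma hit_strict_mono: "k < l \<Longrightarrow> hit k < hit l"
  by (simp add: hit_def)

lemma saddle_before_hit: "\<beta>\<^sub>s < hit k"
  using saddle_angle(2) hit_ge[of k] by linarith

lemma continuous_on_slowness_P:
  assumes "0 \<le> a" "a < a\<^sub>s"
  shows "continuous_on S (\<lambda>\<beta>. slowness (a * P \<beta>) / \<omega>)"
  using assms omega_pos below_saddle
  by (intro continuous_intros continuous_on_compose2[OF continuous_on_slowness] continuous_on_P) auto

lemma slowness_P_pos: "0 \<le> a \<Longrightarrow> a < a\<^sub>s \<Longrightarrow> 0 < slowness (a * P \<beta>) / \<omega>"
  using slowness_pos below_saddle omega_pos by simp

lemma slowness_P_integrable: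
  "0 \<le> a \<Longrightarrow> a < a\<^sub>s \<Longrightarrow> (\<lambda>\<beta>. slowness (a * P \<beta>) / \<omega>) integrable_on {u..v}"
  by (intro integrable_continuous_real continuous_on_slowness_P)

text \<open>For negative \<open>u\<close> the interval \<open>{0..u}\<close> is empty and
  \<open>transit a u\<close> is \<open>0\<close>. \<open>F\<close> is the differentiable
  continuation that can be inverted on the whole line.\<close>

lemma transit_antiderivative:
  assumes "0 \<le> a" "a < a\<^sub>s"
  obtains F where "\<And>u. (F has_real_derivative slowness (a * P u) / \<omega>) (at u)"
    "\<And>u. 0 \<le> u \<Longrightarrow> F u = transit a u"
proof -
  have "isCont (\<lambda>\<beta>. slowness (a * P \<beta>) / \<omega>) u" for u
    using continuous_on_slowness_P[OF assms, of UNIV] by (simp add: continuous_on_eq_continuous_at)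
  then obtain F\<^sub>0 where F0: "\<And>u. (F\<^sub>0 has_vector_derivative slowness (a * P u) / \<omega>) (at u)"
    using einterval_antiderivative[of "- \<infinity>" \<infinity> "\<lambda>\<beta>. slowness (a * P \<beta>) / \<omega>"] by auto
  have "F\<^sub>0 u - F\<^sub>0 0 = transit a u" if "0 \<le> u" for u
    unfolding transit_def
    by (rule integral_unique[symmetric], rule fundamental_theorem_of_calculus[OF that])
       (rule has_vector_derivative_at_within[OF F0])
  moreover have "((\<lambda>u. F\<^sub>0 u - F\<^sub>0 0) has_real_derivative slowness (a * P u) / \<omega>) (at u)" for u
    using F0[of u] by (auto intro!: derivative_eq_intros simp: has_real_derivative_iff_has_vector_derivative)
  ultimately show ?thesis using that[of "\<lambda>u. F\<^sub>0 u - F\<^sub>0 0"] by auto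
qed

lemma transit_strict_mono:
  assumes "0 \<le> a" "a < a\<^sub>s" "0 \<le> u" "u < v"
  shows "transit a u < transit a v"
proof -
  obtain F where F: "\<And>u. (F has_real_derivative slowness (a * P u) / \<omega>) (at u)"
    "\<And>u. 0 \<le> u \<Longrightarrow> F u = transit a u"
    using transit_antiderivative[OF assms(1,2)] by metis
  have "F u < F v"
    using DERIV_pos_imp_increasing[OF \<open>u < v\<close>, of F] F(1) slowness_P_pos[OF assms(1,2)] by blast
  then show ?thesis using F(2) assms by simp
qed

text \<open>The limit of small amplitude is uniform rotation with speed \<omega>. At the angle
  \<open>hit 0\<close> this time is the critical time.\<close>

lemma transit_0: "0 \<le> u \<Longrightarrow> transit 0 u = u / \<omega>"
  by (simp add: transit_def slowness_def branch_0)

lemma continuous_on_transit: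
  "continuous_on {0..<a\<^sub>s} (\<lambda>a. transit a u)"
proof -
  have "continuous_on ({0..<a\<^sub>s} \<times> cbox 0 u) (\<lambda>z. slowness (fst z * P (snd z)) / \<omega>)"
    using omega_pos below_saddle
    by (intro continuous_intros continuous_on_compose2[OF continuous_on_slowness]
        continuous_on_compose2[OF continuous_on_P[of UNIV]]) auto
  then show ?thesis
    unfolding transit_def [abs_def]
    using integral_continuous_on_param[of "{0..<a\<^sub>s}" 0 u "\<lambda>a \<beta>. slowness (a * P \<beta>) / \<omega>"]
    by (simp add: case_prod_unfold)
qed

text \<open>Up to the derivative of \<open>- \<bar>sin (\<beta> + \<gamma>)\<bar>\<^sup>3 / (3 \<omega>\<^sup>2)\<close>, \<^term>\<open>P \<beta>\<close> is the nonnegative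
  \<open>2 \<eta> \<bar>sin (\<beta> + \<gamma>)\<bar>\<^sup>3 / \<omega>\<^sup>3\<close>.\<close>

lemma integral_P_pos: "0 < integral {0..hit k} P"
proof -
  define s where "s = (\<lambda>\<beta>. sin (\<beta> + \<gamma>))"
  define q where "q = (\<lambda>\<beta>. - (1 / \<omega>\<^sup>2) * (cos (\<beta> + \<gamma>) * (s \<beta> * \<bar>s \<beta>\<bar>)))"
  define Q where "Q = (\<lambda>\<beta>. - (1 / (3 * \<omega>\<^sup>2)) * (s \<beta> * (s \<beta> * \<bar>s \<beta>\<bar>)))"
  have "(Q has_real_derivative q \<beta>) (at \<beta> within S)" for \<beta> S
    unfolding Q_def q_def s_def using omega_pos
    by (auto intro!: derivative_eq_intros simp: field_simps)
  then have int: "(q has_integral (Q (hit k) - Q 0)) {0..hit k}"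
    using hit_pos[of k]
    by (intro fundamental_theorem_of_calculus) (auto simp flip: has_real_derivative_iff_has_vector_derivative)
  have "sin ((real k + 1) * pi) = 0"
    using sin_npi[of "Suc k"] by (simp add: algebra_simps)
  \<comment> \<open>At every angle \<open>hit k\<close> the boundary term vanishes, so the integral
    of \<open>q\<close> is \<omega> / 3 for all \<open>k\<close>.\<close>
  then have "Q (hit k) = 0" by (simp add: Q_def s_def hit_def)
  moreover have "Q 0 = - (\<omega> / 3)"
    using omega_pos by (simp add: Q_def s_def sin_gamma power2_eq_square)
  ultimately have q: "(q has_integral \<omega> / 3) {0..hit k}" using int by simp
  have "q \<beta> \<le> P \<beta>" for \<beta>
  proof -
    have "sin \<beta> = sin ((\<beta> + \<gamma>) - \<gamma>)" by simp
    also have "\<dots> = 2 * \<eta> * s \<beta> - \<omega> * cos (\<beta> + \<gamma>)"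
      unfolding sin_diff cos_gamma sin_gamma s_def by (simp add: mult.commute)
    finally have sin: "sin \<beta> = 2 * \<eta> * s \<beta> - \<omega> * cos (\<beta> + \<gamma>)" .
    have "P \<beta> = sin \<beta> * (s \<beta> * \<bar>s \<beta>\<bar>) / \<omega> ^ 3" by (simp add: P_def s_def)
    then have "P \<beta> - q \<beta> = 2 * \<eta> * (s \<beta> * s \<beta>) * \<bar>s \<beta>\<bar> / \<omega> ^ 3"
      using omega_pos
      unfolding sin q_def
      by (simp add: field_simps power2_eq_square power3_eq_cube)
    also have "\<dots> \<ge> 0" using omega_pos eta_nonneg by simp
    finally show ?thesis by simp
  qed
  then have "\<omega> / 3 \<le> integral {0..hit k} P"
    by (intro has_integral_le[OF q integrable_integral[OF integrable_continuous_real[OF continuous_on_P]]])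
  then show ?thesis using omega_pos by linarith
qed

text \<open>The integrand is not monotone in the amplitude at angles where \<open>P\<close> is
  negative. Integrating \<open>slowness_diff\<close> bounds the difference below by a positive
  multiple of the integral of \<open>P\<close> up to \<open>hit k\<close>.\<close>

lemma transit_strict_mono_amplitude:
  assumes "0 \<le> a" "a < b" "b < a\<^sub>s"
  shows "transit a (hit k) < transit b (hit k)"
proof -
  let ?I = "{0..hit k}"
  have "3/2 * (b - a) / \<omega> * integral ?I P = integral ?I (\<lambda>\<beta>. 3/2 * (b - a) / \<omega> * P \<beta>)"
    by simp
  also have "\<dots> \<le> integral ?I (\<lambda>\<beta>. slowness (b * P \<beta>) / \<omega> - slowness (a * P \<beta>) / \<omega>)"
  proof (rule integral_le)
    show "(\<lambda>\<beta>. 3/2 * (b - a) / \<omega> * P \<beta>) integrable_on ?I"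
      by (intro integrable_continuous_real continuous_on_mult_left continuous_on_P)
    show "(\<lambda>\<beta>. slowness (b * P \<beta>) / \<omega> - slowness (a * P \<beta>) / \<omega>) integrable_on ?I"
      using assms by (intro integrable_diff slowness_P_integrable) auto
    fix \<beta>
    have "3/2 * (b - a) * P \<beta> \<le> slowness (b * P \<beta>) - slowness (a * P \<beta>)"
      using assms by (intro slowness_diff below_saddle) auto
    then have "3/2 * (b - a) * P \<beta> / \<omega> \<le> (slowness (b * P \<beta>) - slowness (a * P \<beta>)) / \<omega>"
      using omega_pos by (intro divide_right_mono) auto
    then show "3/2 * (b - a) / \<omega> * P \<beta> \<le> slowness (b * P \<beta>) / \<omega> - slowness (a * P \<beta>) / \<omega>"
      by (simp only: diff_divide_distrib times_divide_eq_left)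
  qed
  also have "\<dots> = transit b (hit k) - transit a (hit k)"
    unfolding transit_def using assms by (intro integral_diff slowness_P_integrable) auto
  finally show ?thesis
    using mult_pos_pos[OF _ integral_P_pos[of k], of "3/2 * (b - a) / \<omega>"] assms omega_pos by simp
qed

section \<open>Construction of the orbits, and slow passage near the saddle\<close>

text \<open>With \<open>E = r\<^sup>2 - r ^ 3 * P \<beta>\<close>, the rates are Hamiltonian:
  \<open>\<beta>'\<close> is \<open>\<omega> / (2 * r)\<close> times the \<open>r\<close>-derivative
  of \<open>E\<close>, and \<open>r'\<close> is minus that factor times its
  \<beta>-derivative.\<close>

lemma polar_field:
  fixes r \<beta> :: real
  assumes "0 < r"
  defines "x \<equiv> r * sin \<beta> / \<omega>" and "y \<equiv> r * sin (\<beta> + \<gamma>) / \<omega>"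
    and "r' \<equiv> r\<^sup>2 * \<omega> * P' \<beta> / 2" and "\<beta>' \<equiv> \<omega> * (1 - 3/2 * (r * P \<beta>))"
  shows "(r' * sin \<beta> + r * (cos \<beta> * \<beta>')) / \<omega> = y - x * \<bar>y\<bar> - 2 * \<eta> * x"
    and "(r' * sin (\<beta> + \<gamma>) + r * (cos (\<beta> + \<gamma>) * \<beta>')) / \<omega> = - (x - 1/2 * y * \<bar>y\<bar> - 2 * \<eta> * y)"
proof -
  define X C s c m where "X = sin \<beta>" and "C = cos \<beta>" and "s = sin (\<beta> + \<gamma>)"
    and "c = cos (\<beta> + \<gamma>)" and "m = \<bar>s\<bar>"
  have s: "s = 2 * \<eta> * X + \<omega> * C" and c: "c = 2 * \<eta> * C - \<omega> * X"
    by (simp_all add: s_def c_def X_def C_def sin_shift cos_shift)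
  \<comment> \<open>The cubic terms collapse to this combination, the sine of the constant angle
    \<gamma>.\<close>
  have cross: "C * s - X * c = \<omega>"
    using sin_diff[of "\<beta> + \<gamma>" \<beta>] by (simp add: X_def C_def s_def c_def sin_gamma mult.commute)
  have r': "r' = r\<^sup>2 * (C * (s * m) + 2 * X * m * c) / (2 * \<omega>\<^sup>2)"
    using omega_pos
    by (simp add: r'_def P'_def X_def C_def s_def c_def m_def power2_eq_square power3_eq_cube)
  have b': "\<beta>' = \<omega> - 3/2 * (r * (X * (s * m))) / \<omega>\<^sup>2"
    using omega_pos
    by (simp add: \<beta>'_def P_def X_def s_def m_def power2_eq_square power3_eq_cube field_simps)
  have y_abs: "\<bar>y\<bar> = r * m / \<omega>"
    using assms(1) omega_pos by (simp add: y_def s_def m_def abs_mult)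
  have xX: "x = r * X / \<omega>" and ys: "y = r * s / \<omega>" by (simp_all add: x_def y_def X_def s_def)
  have rC: "r * C = y - 2 * \<eta> * x"
    using omega_pos unfolding xX ys s by (simp add: field_simps)
  have rc: "r * c = 2 * \<eta> * y - x"
  proof -
    have "r * c = 2 * \<eta> * (r * C) - \<omega>\<^sup>2 * x"
      using omega_pos unfolding c xX by (simp add: algebra_simps power2_eq_square)
    then show ?thesis
      unfolding rC omega_sq by (simp add: algebra_simps power2_eq_square)
  qed
  have "(r' * X + r * (C * \<beta>')) / \<omega> = r * C - r\<^sup>2 * X * m * (C * s - X * c) / \<omega> ^ 3"
    using omega_pos unfolding r' b'
    by (simp add: field_simps power2_eq_square power3_eq_cube)
  also have "\<dots> = y - x * \<bar>y\<bar> - 2 * \<eta> * x"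
    using omega_pos unfolding cross rC y_abs xX
    by (simp add: power2_eq_square power3_eq_cube)
  finally show "(r' * sin \<beta> + r * (cos \<beta> * \<beta>')) / \<omega> = y - x * \<bar>y\<bar> - 2 * \<eta> * x"
    by (simp only: X_def C_def)
  have "(r' * s + r * (c * \<beta>')) / \<omega> = r * c + r\<^sup>2 * s * m * (C * s - X * c) / (2 * \<omega> ^ 3)"
    using omega_pos unfolding r' b'
    by (simp add: field_simps power2_eq_square power3_eq_cube)
  also have "\<dots> = - (x - 1/2 * y * \<bar>y\<bar> - 2 * \<eta> * y)"
    using omega_pos unfolding cross rc y_abs
    by (simp add: ys power2_eq_square power3_eq_cube mult_ac)
  finally show "(r' * sin (\<beta> + \<gamma>) + r * (cos (\<beta> + \<gamma>) * \<beta>')) / \<omega> = - (x - 1/2 * y * \<bar>y\<bar> - 2 * \<eta> * y)"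
    by (simp only: s_def c_def)
qed

text \<open>The angle is obtained by inverting the transit time, and the radius then follows from
  the energy. As \<open>w < 2/3\<close> throughout, the radius stays below
  \<open>sqrt 3 * a\<close>.\<close>

lemma orbit_exists:
  assumes "0 < a" "a < a\<^sub>s"
  obtains \<rho> \<beta> where
    "\<And>I. xy_flow \<eta> I (\<lambda>t. \<rho> t * sin (\<beta> t) / \<omega>) (\<lambda>t. \<rho> t * sin (\<beta> t + \<gamma>) / \<omega>)"
    "\<rho> 0 = a" "\<beta> 0 = 0" "\<And>t. 0 < \<rho> t" "\<And>t. (\<rho> t)\<^sup>2 \<le> 3 * a\<^sup>2"
    "\<And>t. \<rho> t * P (\<beta> t) = branch (a * P (\<beta> t))"
    "\<And>t. 0 \<le> t \<Longrightarrow> 0 \<le> \<beta> t \<and> transit a (\<beta> t) = t"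
    "\<And>u. 0 \<le> u \<Longrightarrow> \<beta> (transit a u) = u"
proof -
  have a: "0 \<le> a" using assms by simp
  note below = below_saddle[OF a assms(2)]
  obtain F where F: "\<And>u. (F has_real_derivative slowness (a * P u) / \<omega>) (at u)"
    "\<And>u. 0 \<le> u \<Longrightarrow> F u = transit a u"
    using transit_antiderivative[OF a assms(2)] by metis
  \<comment> \<open>A lower bound of \<open>a * P \<beta>\<close> over all angles; the slowness
    there gives the positive constant needed to invert \<open>F\<close>.\<close>
  define z\<^sub>0 where "z\<^sub>0 = a * (- (1 / \<omega> ^ 3))"
  have z0: "z\<^sub>0 \<le> a * P \<beta>" for \<beta>
    unfolding z\<^sub>0_def using P_ge a by (intro mult_left_mono)
  then have z0_less: "z\<^sub>0 < amplitude (2/3)" using below by (rule le_less_trans)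
  have "slowness z\<^sub>0 / \<omega> \<le> slowness (a * P u) / \<omega>" for u
    using slowness_mono[OF z0 below] omega_pos by (simp add: divide_right_mono)
  moreover have "0 < slowness z\<^sub>0 / \<omega>" using slowness_pos[OF z0_less] omega_pos by simp
  ultimately obtain \<beta> where \<beta>: "\<And>t. F (\<beta> t) = t" "\<And>u. \<beta> (F u) = u"
    "\<And>t. (\<beta> has_real_derivative 1 / (slowness (a * P (\<beta> t)) / \<omega>)) (at t)"
    using inverse_of_antiderivative[OF F(1)] by metis
  define w where "w = (\<lambda>t. branch (a * P (\<beta> t)))"
  \<comment> \<open>The positive solution of the energy equation
    \<open>\<rho>\<^sup>2 * (1 - w) = a\<^sup>2\<close>.\<close>
  define \<rho> where "\<rho> = (\<lambda>t. a / sqrt (1 - w t))"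
  have w_less: "w t < 2/3" for t unfolding w_def using branch_less[OF below] .
  have \<rho>_pos: "0 < \<rho> t" for t using assms(1) w_less[of t] by (simp add: \<rho>_def)
  have \<rho>_sq: "(\<rho> t)\<^sup>2 = a\<^sup>2 / (1 - w t)" for t
    using w_less[of t] by (simp add: \<rho>_def power_divide)
  have \<rho>P: "\<rho> t * P (\<beta> t) = w t" for t
  proof -
    have "a * P (\<beta> t) = w t * sqrt (1 - w t)"
      using amplitude_branch[OF less_imp_le[OF below[of "\<beta> t"]]] by (simp add: w_def amplitude_def)
    then show ?thesis using w_less[of t] by (simp add: \<rho>_def)
  qed
  have \<beta>': "(\<beta> has_real_derivative \<omega> * (1 - 3/2 * (\<rho> t * P (\<beta> t)))) (at t)" for t
    using \<beta>(3)[of t] unfolding \<rho>P by (simp add: slowness_def w_def mult.commute)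
  have w': "(w has_real_derivative sqrt (1 - w t) * a * \<omega> * P' (\<beta> t)) (at t)" for t
  proof -
    have "((\<lambda>t. a * P (\<beta> t)) has_real_derivative a * (P' (\<beta> t) * (\<omega> * (1 - 3/2 * w t)))) (at t)"
      using DERIV_cmult[OF DERIV_chain2[OF P_deriv \<beta>'], of a t] unfolding \<rho>P .
    from DERIV_chain2[OF branch_deriv[OF below] this]
    have "(w has_real_derivative sqrt (1 - w t) / (1 - 3/2 * w t) *
        (a * (P' (\<beta> t) * (\<omega> * (1 - 3/2 * w t))))) (at t)"
      unfolding w_def .
    \<comment> \<open>The factor \<open>1 - 3/2 * w\<close> of the angular speed cancels the
      denominator in the derivative of \<open>branch\<close>.\<close>
    moreover have "s / d * (a * (p * (\<omega> * d))) = s * a * \<omega> * p" if "d \<noteq> 0" for s d p :: real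
      using that by simp
    moreover have "1 - 3/2 * w t \<noteq> 0" using w_less[of t] by simp
    ultimately show ?thesis by metis
  qed
  have \<rho>': "(\<rho> has_real_derivative (\<rho> t)\<^sup>2 * \<omega> * P' (\<beta> t) / 2) (at t)" for t
  proof -
    have "0 < 1 - w t" using w_less[of t] by simp
    moreover from this have "sqrt (1 - w t) * sqrt (1 - w t) = 1 - w t" by simp
    ultimately show ?thesis
      unfolding \<rho>_sq unfolding \<rho>_def
      by (auto intro!: derivative_eq_intros w' simp: field_simps power2_eq_square)
  qed
  have flow: "xy_flow \<eta> I (\<lambda>t. \<rho> t * sin (\<beta> t) / \<omega>) (\<lambda>t. \<rho> t * sin (\<beta> t + \<gamma>) / \<omega>)" for I
    unfolding xy_flow_def
  proof (intro ballI conjI)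
    fix t
    have "((\<lambda>t. \<rho> t * sin (\<beta> t)) has_real_derivative
        (\<rho> t)\<^sup>2 * \<omega> * P' (\<beta> t) / 2 * sin (\<beta> t)
          + \<rho> t * (cos (\<beta> t) * (\<omega> * (1 - 3/2 * (\<rho> t * P (\<beta> t)))))) (at t within I)"
      by (rule has_field_derivative_at_within)
         (auto intro!: derivative_eq_intros \<rho>' \<beta>' simp: algebra_simps)
    from DERIV_cdivide[OF this, of \<omega>] show "((\<lambda>t. \<rho> t * sin (\<beta> t) / \<omega>) has_real_derivative
        \<rho> t * sin (\<beta> t + \<gamma>) / \<omega> - \<rho> t * sin (\<beta> t) / \<omega> * \<bar>\<rho> t * sin (\<beta> t + \<gamma>) / \<omega>\<bar>
          - 2 * \<eta> * (\<rho> t * sin (\<beta> t) / \<omega>)) (at t within I)"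
      unfolding polar_field(1)[OF \<rho>_pos] .
    have "((\<lambda>t. \<rho> t * sin (\<beta> t + \<gamma>)) has_real_derivative
        (\<rho> t)\<^sup>2 * \<omega> * P' (\<beta> t) / 2 * sin (\<beta> t + \<gamma>)
          + \<rho> t * (cos (\<beta> t + \<gamma>) * (\<omega> * (1 - 3/2 * (\<rho> t * P (\<beta> t)))))) (at t within I)"
      by (rule has_field_derivative_at_within)
         (auto intro!: derivative_eq_intros \<rho>' \<beta>' simp: algebra_simps)
    from DERIV_cdivide[OF this, of \<omega>] show "((\<lambda>t. \<rho> t * sin (\<beta> t + \<gamma>) / \<omega>) has_real_derivative
        - (\<rho> t * sin (\<beta> t) / \<omega> - 1/2 * (\<rho> t * sin (\<beta> t + \<gamma>) / \<omega>) * \<bar>\<rho> t * sin (\<beta> t + \<gamma>) / \<omega>\<bar>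
          - 2 * \<eta> * (\<rho> t * sin (\<beta> t + \<gamma>) / \<omega>))) (at t within I)"
      unfolding polar_field(2)[OF \<rho>_pos] .
  qed
  have "F 0 = 0" using F(2)[of 0] by (simp add: transit_def)
  then have \<beta>0: "\<beta> 0 = 0" using \<beta>(2)[of 0] by simp
  have "w 0 = 0" by (simp add: w_def \<beta>0 P_def branch_0)
  then have "\<rho> 0 = a" by (simp add: \<rho>_def)
  have \<rho>_bound: "(\<rho> t)\<^sup>2 \<le> 3 * a\<^sup>2" for t
  proof -
    have "a\<^sup>2 / (1 - w t) \<le> a\<^sup>2 / (1/3)"
      using w_less[of t] by (intro divide_left_mono) auto
    then show ?thesis by (simp add: \<rho>_sq)
  qed
  have \<beta>_transit: "0 \<le> \<beta> t \<and> transit a (\<beta> t) = t" if "0 \<le> t" for t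
  proof -
    have "0 \<le> \<beta> t"
    proof (rule ccontr)
      assume "\<not> 0 \<le> \<beta> t"
      then have "F (\<beta> t) < F 0"
        using DERIV_pos_imp_increasing[of "\<beta> t" 0 F] F(1) slowness_P_pos[OF a assms(2)] by force
      then show False using that by (simp add: \<beta>(1) \<open>F 0 = 0\<close>)
    qed
    then show ?thesis using F(2)[of "\<beta> t"] \<beta>(1)[of t] by simp
  qed
  show ?thesis
  proof (rule that[of \<rho> \<beta>])
    show "\<beta> (transit a u) = u" if "0 \<le> u" for u
      using \<beta>(2)[of u] F(2)[OF that] by simp
  qed (use flow \<open>\<rho> 0 = a\<close> \<beta>0 \<rho>_pos \<rho>_bound \<rho>P \<beta>_transit in \<open>auto simp: w_def\<close>)
qed

text \<open>Orbits of amplitude close to \<open>a\<^sub>s\<close> cross the ray through the saddle close to the saddle,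
  and by Gronwall's inequality it takes long to come near an equilibrium.\<close>

lemma transit_unbounded:
  obtains a where "0 < a" "a < a\<^sub>s" "T < transit a \<beta>\<^sub>s"
proof (rule ccontr)
  assume "\<not> thesis"
  then have short: "transit a \<beta>\<^sub>s \<le> T" if "0 < a" "a < a\<^sub>s" for a
    using that \<open>\<And>a. 0 < a \<Longrightarrow> a < a\<^sub>s \<Longrightarrow> T < transit a \<beta>\<^sub>s \<Longrightarrow> thesis\<close> by (meson not_le)
  define p where "p = P \<beta>\<^sub>s"
  have "0 < p" using saddle_angle(4) by (simp add: p_def)
  \<comment> \<open>\<open>M\<close> bounds all orbits below the saddle level, whose radius is at
    most \<open>2 * a\<^sub>s\<close>, and the saddle itself. Hence the Gronwall constant
    \<open>K\<close> does not depend on the orbit.\<close>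
  define M where "M = Max {2 * a\<^sub>s / \<omega>, \<bar>saddle_x\<bar>, \<bar>saddle_y\<bar>}"
  define L where "L = 3 * M + 4 * \<eta>"
  define K where "K = 2 / (p * \<omega>)\<^sup>2 * exp (L * T)"
  have M: "2 * a\<^sub>s / \<omega> \<le> M" "\<bar>saddle_x\<bar> \<le> M" "\<bar>saddle_y\<bar> \<le> M" by (auto simp: M_def)
  have "0 \<le> M" using M(2) by linarith
  then have "0 \<le> L" using eta_nonneg by (simp add: L_def)
  have "0 \<le> K" by (simp add: K_def)
  have bound: "saddle_x\<^sup>2 \<le> K * (w - 2/3)\<^sup>2" if w: "0 < w" "w < 2/3" for w
  proof -
    \<comment> \<open>Amplitudes are parametrised by the value \<open>w\<close> of
      \<open>\<rho> * P\<close> at the angle \<open>\<beta>\<^sub>s\<close>; there the distance to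
      the saddle is proportional to \<open>2/3 - w\<close>.\<close>
    define a where "a = amplitude w / p"
    have a: "0 < a" "a < a\<^sub>s"
      using w \<open>0 < p\<close> amplitude_strict_mono[of w "2/3"]
      by (auto simp: a_def a\<^sub>s_def amplitude_def[of w] p_def divide_strict_right_mono)
    obtain \<rho> \<beta> where orbit:
      "\<And>I. xy_flow \<eta> I (\<lambda>t. \<rho> t * sin (\<beta> t) / \<omega>) (\<lambda>t. \<rho> t * sin (\<beta> t + \<gamma>) / \<omega>)"
      "\<rho> 0 = a" "\<beta> 0 = 0" "\<And>t. 0 < \<rho> t" "\<And>t. (\<rho> t)\<^sup>2 \<le> 3 * a\<^sup>2"
      "\<And>t. \<rho> t * P (\<beta> t) = branch (a * P (\<beta> t))"
      "\<And>t. 0 \<le> t \<Longrightarrow> 0 \<le> \<beta> t \<and> transit a (\<beta> t) = t"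
      "\<And>u. 0 \<le> u \<Longrightarrow> \<beta> (transit a u) = u"
      using orbit_exists[OF a] by blast
    define x y where "x = (\<lambda>t. \<rho> t * sin (\<beta> t) / \<omega>)" and "y = (\<lambda>t. \<rho> t * sin (\<beta> t + \<gamma>) / \<omega>)"
    define t where "t = transit a \<beta>\<^sub>s"
    have t: "0 \<le> t" "t \<le> T"
      using transit_strict_mono[of a 0 "\<beta>\<^sub>s"] saddle_angle(1) a short[OF a]
      by (auto simp: t_def transit_def)
    have \<rho>_le: "\<rho> s \<le> 2 * a\<^sub>s" for s
    proof (rule power2_le_imp_le)
      have "a\<^sup>2 \<le> a\<^sub>s\<^sup>2" using a by (intro power_mono) auto
      then have "(\<rho> s)\<^sup>2 \<le> 4 * a\<^sub>s\<^sup>2"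
        using orbit(5)[of s] zero_le_power2[of "a\<^sub>s"] by linarith
      then show "(\<rho> s)\<^sup>2 \<le> (2 * a\<^sub>s)\<^sup>2" by (simp add: power_mult_distrib)
    qed (use a_s_pos in auto)
    have "\<bar>\<rho> s * sin \<alpha> / \<omega>\<bar> \<le> M" for s \<alpha>
    proof -
      have "\<rho> s * \<bar>sin \<alpha>\<bar> \<le> (2 * a\<^sub>s) * 1"
        using \<rho>_le[of s] a_s_pos by (intro mult_mono) auto
      then have "\<rho> s * \<bar>sin \<alpha>\<bar> / \<omega> \<le> 2 * a\<^sub>s / \<omega>"
        using omega_pos by (intro divide_right_mono) auto
      moreover have "\<bar>\<rho> s * sin \<alpha> / \<omega>\<bar> = \<rho> s * \<bar>sin \<alpha>\<bar> / \<omega>"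
        using orbit(4)[of s] omega_pos by (simp add: abs_mult)
      ultimately show ?thesis using M(1) by linarith
    qed
    then have "(x 0 - saddle_x)\<^sup>2 + (y 0 - saddle_y)\<^sup>2
        \<le> ((x t - saddle_x)\<^sup>2 + (y t - saddle_y)\<^sup>2) * exp (L * (t - 0))"
      unfolding L_def
      by (intro xy_flow_distance(2)[OF eta_nonneg t(1) _ saddle_equilibrium])
         (use orbit(1) M in \<open>auto simp: x_def y_def\<close>)
    also have "\<dots> \<le> ((x t - saddle_x)\<^sup>2 + (y t - saddle_y)\<^sup>2) * exp (L * T)"
      using t \<open>0 \<le> L\<close> by (intro mult_left_mono) (auto intro!: mult_left_mono)
    also have "\<dots> \<le> 2 * ((w - 2/3) / (p * \<omega>))\<^sup>2 * exp (L * T)"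
    proof (rule mult_right_mono)
      have "\<beta> t = \<beta>\<^sub>s" using orbit(8) saddle_angle(1) by (simp add: t_def)
      then have "\<rho> t * p = w"
        using orbit(6)[of t] w branch_amplitude[of w] \<open>0 < p\<close> by (simp add: p_def a_def)
      then have \<rho>: "\<rho> t = w / p" using \<open>0 < p\<close> by (simp add: field_simps)
      have x: "x t - saddle_x = (w - 2/3) / (p * \<omega>) * sin \<beta>\<^sub>s"
        using \<open>0 < p\<close> omega_pos
        by (simp add: x_def saddle_x_def \<rho> \<open>\<beta> t = \<beta>\<^sub>s\<close> field_simps flip: p_def)
      have y: "y t - saddle_y = (w - 2/3) / (p * \<omega>) * sin (\<beta>\<^sub>s + \<gamma>)"
        using \<open>0 < p\<close> omega_pos
        by (simp add: y_def saddle_y_def \<rho> \<open>\<beta> t = \<beta>\<^sub>s\<close> field_simps flip: p_def)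
      have "(sin \<alpha>)\<^sup>2 \<le> 1" for \<alpha> :: real by (simp add: abs_square_le_1)
      then have sq: "(q * sin \<alpha>)\<^sup>2 \<le> q\<^sup>2" for q \<alpha> :: real
        unfolding power_mult_distrib by (intro mult_left_le) auto
      show "(x t - saddle_x)\<^sup>2 + (y t - saddle_y)\<^sup>2 \<le> 2 * ((w - 2/3) / (p * \<omega>))\<^sup>2"
        unfolding x y using add_mono[OF sq sq] by (simp only: mult_2)
    qed simp
    also have "\<dots> = K * (w - 2/3)\<^sup>2" by (simp add: K_def power_divide)
    finally have "saddle_x\<^sup>2 + (y 0 - saddle_y)\<^sup>2 \<le> K * (w - 2/3)\<^sup>2"
      by (simp add: x_def orbit(2,3))
    then show ?thesis using zero_le_power2[of "y 0 - saddle_y"] by linarith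
  qed
  \<comment> \<open>Small enough for \<open>K * d\<^sup>2 < saddle_x\<^sup>2\<close>, while
    \<open>d \<le> 1/3\<close> keeps \<open>w = 2/3 - d\<close> positive and gives
    \<open>d\<^sup>2 \<le> d\<close>.\<close>
  define d where "d = min (1/3) (saddle_x\<^sup>2 / (K + 1))"
  have "0 < saddle_x\<^sup>2 / (K + 1)" using saddle_x_pos \<open>0 \<le> K\<close> by simp
  then have "0 < d" by (simp add: d_def)
  have d: "0 < d" "d \<le> 1/3" "d \<le> saddle_x\<^sup>2 / (K + 1)"
    by fact (simp_all only: d_def min.cobounded1 min.cobounded2)
  have "saddle_x\<^sup>2 \<le> K * d\<^sup>2" using bound[of "2/3 - d"] d by simp
  also have "\<dots> \<le> K * d"
    using \<open>0 \<le> K\<close> d by (intro mult_left_mono) (auto simp: power2_eq_square mult_left_le)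
  also have "\<dots> < (K + 1) * d" using d by (simp add: algebra_simps)
  also have "\<dots> \<le> saddle_x\<^sup>2" using d(3) \<open>0 \<le> K\<close> by (simp add: field_simps)
  finally show False by simp
qed

section \<open>Counting the amplitudes that reach the \<open>x\<close>-axis at time
  \<open>T\<close>\<close>

definition hitting_amplitudes :: "real \<Rightarrow> real set" where
  "hitting_amplitudes T = {a. 0 < a \<and> a < a\<^sub>s \<and> (\<exists>k. transit a (hit k) = T)}"

text \<open>As the amplitude grows from \<open>0\<close>, the time to \<open>hit k\<close> increases
  continuously from \<open>hit k / \<omega>\<close> beyond every bound, so each \<open>k\<close>
  with \<open>hit k / \<omega> < T\<close> yields exactly one amplitude and no other
  \<open>k\<close> yields any. Different \<open>k\<close> give different amplitudes because one
  orbit passes the angles at different times.\<close>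

lemma card_hitting_amplitudes:
  "finite (hitting_amplitudes T) \<and> card (hitting_amplitudes T) = nat \<lceil>(T - (pi - \<gamma>) / \<omega>) * \<omega> / pi\<rceil>"
proof -
  define K where "K = {k. hit k / \<omega> < T}"
  define v where "v = (T - (pi - \<gamma>) / \<omega>) * \<omega> / pi"
  have "v = (T * \<omega> - (pi - \<gamma>)) / pi"
    unfolding v_def left_diff_distrib using omega_pos by simp
  then have "k \<in> K \<longleftrightarrow> real k < v" for k
    using omega_pos by (simp add: K_def hit_def pos_divide_less_eq pos_less_divide_eq algebra_simps)
  \<comment> \<open>The strict inequality is what produces a ceiling; for negative \<open>v\<close>
    there is no such \<open>k\<close>, in accordance with \<open>nat\<close>.\<close>
  then have "k \<in> K \<longleftrightarrow> k < nat \<lceil>v\<rceil>" for k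
    by (simp add: zless_nat_eq_int_zless less_ceiling_iff)
  then have K: "K = {..<nat \<lceil>v\<rceil>}" by auto
  have "\<exists>a. 0 < a \<and> a < a\<^sub>s \<and> transit a (hit k) = T" if "k \<in> K" for k
  proof -
    \<comment> \<open>An orbit that is slow to reach the saddle angle is slower still to reach
      \<open>hit k\<close>, which lies beyond it.\<close>
    obtain b where b: "0 < b" "b < a\<^sub>s" "T < transit b \<beta>\<^sub>s" using transit_unbounded by metis
    have "T \<le> transit b (hit k)"
      using b transit_strict_mono[of b "\<beta>\<^sub>s" "hit k"] saddle_angle(1) saddle_before_hit by force
    moreover have T: "transit 0 (hit k) < T"
      using that hit_pos[of k] by (simp add: K_def transit_0)
    moreover have "continuous_on {0..b} (\<lambda>a. transit a (hit k))"
      using b by (intro continuous_on_subset[OF continuous_on_transit]) auto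
    ultimately obtain a where "0 \<le> a" "a \<le> b" "transit a (hit k) = T"
      using IVT'[of "\<lambda>a. transit a (hit k)" 0 T b] b by auto
    moreover from this T have "a \<noteq> 0" by auto
    ultimately show ?thesis using b by (intro exI[of _ a]) auto
  qed
  then obtain A where A: "\<And>k. k \<in> K \<Longrightarrow> 0 < A k \<and> A k < a\<^sub>s \<and> transit (A k) (hit k) = T"
    by metis
  have "inj_on A K"
  proof (rule linorder_inj_onI')
    fix k l assume "k \<in> K" "l \<in> K" "k < l"
    then show "A k \<noteq> A l"
      using A[of k] A[of l] transit_strict_mono[of "A k" "hit k" "hit l"] hit_pos[of k] hit_strict_mono
      by force
  qed
  moreover have "A ` K = hitting_amplitudes T"
  proof (intro equalityI subsetI)
    fix a assume "a \<in> hitting_amplitudes T"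
    then obtain k where a: "0 < a" "a < a\<^sub>s" "transit a (hit k) = T"
      by (auto simp: hitting_amplitudes_def)
    then have "k \<in> K"
      using transit_strict_mono_amplitude[of 0 a k] hit_pos[of k] by (simp add: K_def transit_0)
    then have "A k = a"
      using transit_strict_mono_amplitude[of a "A k" k] transit_strict_mono_amplitude[of "A k" a k] a A[of k]
      by (cases "A k" a rule: linorder_cases) auto
    then show "a \<in> A ` K" using \<open>k \<in> K\<close> by blast
  qed (use A in \<open>auto simp: hitting_amplitudes_def\<close>)
  ultimately have "bij_betw A K (hitting_amplitudes T)" by (simp add: bij_betw_def)
  then show ?thesis
    using bij_betw_same_card[of A K] bij_betw_finite[of A K] by (simp add: K v_def)
qed

text \<open>Below the saddle level the trajectory is the explicit orbit, so \<open>y T = 0\<close>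
  means \<open>sin (\<beta> T + \<gamma>) = 0\<close>; at or above that level
  \<open>amplitude_bound\<close> excludes it.\<close>

lemma flow_hits_axis_iff:
  assumes flow: "xy_flow \<eta> {0..T} x y" and "0 < T" and "x 0 = 0" "0 < y 0"
  shows "y T = 0 \<longleftrightarrow> y 0 \<in> hitting_amplitudes T"
proof (cases "y 0 < a\<^sub>s")
  case False
  then show ?thesis
    using amplitude_bound[OF flow \<open>0 < T\<close> \<open>x 0 = 0\<close> \<open>0 < y 0\<close>] by (auto simp: hitting_amplitudes_def)
next
  case True
  obtain \<rho> \<beta> where orbit:
    "\<And>I. xy_flow \<eta> I (\<lambda>t. \<rho> t * sin (\<beta> t) / \<omega>) (\<lambda>t. \<rho> t * sin (\<beta> t + \<gamma>) / \<omega>)"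
    "\<rho> 0 = y 0" "\<beta> 0 = 0" "\<And>t. 0 < \<rho> t" "\<And>t. (\<rho> t)\<^sup>2 \<le> 3 * (y 0)\<^sup>2"
    "\<And>t. \<rho> t * P (\<beta> t) = branch (y 0 * P (\<beta> t))"
    "\<And>t. 0 \<le> t \<Longrightarrow> 0 \<le> \<beta> t \<and> transit (y 0) (\<beta> t) = t"
    "\<And>u. 0 \<le> u \<Longrightarrow> \<beta> (transit (y 0) u) = u"
    using orbit_exists[OF \<open>0 < y 0\<close> True] by blast
  have "x T = \<rho> T * sin (\<beta> T) / \<omega> \<and> y T = \<rho> T * sin (\<beta> T + \<gamma>) / \<omega>"
    by (rule xy_flow_unique[OF eta_nonneg flow orbit(1), of 0 T])
       (use \<open>0 < T\<close> \<open>x 0 = 0\<close> omega_pos in \<open>simp_all add: orbit(2,3) sin_gamma\<close>)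
  then have "y T = 0 \<longleftrightarrow> sin (\<beta> T + \<gamma>) = 0" using orbit(4)[of T] omega_pos by simp
  also have "\<dots> \<longleftrightarrow> (\<exists>k. \<beta> T = hit k)"
  proof
    assume "sin (\<beta> T + \<gamma>) = 0"
    then obtain i :: int where i: "\<beta> T + \<gamma> = of_int i * pi" by (auto simp: sin_zero_iff_int2)
    \<comment> \<open>Since \<open>\<beta> T \<ge> 0\<close> and \<gamma> is positive, the multiple
      of \<pi> has \<open>i \<ge> 1\<close>, and \<open>i - 1\<close> is the index of the
      hit.\<close>
    have "0 < of_int i * pi" unfolding i[symmetric] using orbit(7)[of T] \<open>0 < T\<close> gamma_pos by simp
    then have "0 < i" by (simp add: zero_less_mult_iff)
    then have "of_int i = real (nat (i - 1)) + 1" by simp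
    then have "\<beta> T = hit (nat (i - 1))" using i by (simp only: hit_def)
    then show "\<exists>k. \<beta> T = hit k" ..
  next
    assume "\<exists>k. \<beta> T = hit k"
    then obtain k where "\<beta> T = hit k" ..
    then have "\<beta> T + \<gamma> = of_int (int k + 1) * pi" by (simp add: hit_def)
    then show "sin (\<beta> T + \<gamma>) = 0" unfolding sin_zero_iff_int2 by blast
  qed
  also have "\<dots> \<longleftrightarrow> (\<exists>k. transit (y 0) (hit k) = T)"
  proof
    assume "\<exists>k. \<beta> T = hit k"
    then show "\<exists>k. transit (y 0) (hit k) = T" using orbit(7)[of T] \<open>0 < T\<close> by auto
  next
    assume "\<exists>k. transit (y 0) (hit k) = T"
    then show "\<exists>k. \<beta> T = hit k" using orbit(8)[OF less_imp_le[OF hit_pos]] by auto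
  qed
  also have "\<dots> \<longleftrightarrow> y 0 \<in> hitting_amplitudes T"
    using True \<open>0 < y 0\<close> by (simp add: hitting_amplitudes_def)
  finally show ?thesis .
qed

end

section \<open>Counting solutions by their initial value \<open>y 0\<close>\<close>

lemma xy_solutions_iff:
  "(x, y) \<in> xy_solutions \<eta> T \<longleftrightarrow> x \<in> extensional {0..T} \<and> y \<in> extensional {0..T} \<and>
     xy_flow \<eta> {0..T} x y \<and> x 0 = 0 \<and> y T = 0"
  by (auto simp: xy_solutions_def xy_flow_def)

lemma restrict_flow_in_xy_solutions:
  assumes "xy_flow \<eta> {0..T} x y" "0 < T" "x 0 = 0" "y T = 0"
  shows "(restrict x {0..T}, restrict y {0..T}) \<in> xy_solutions \<eta> T"
  using assms xy_flow_cong[OF assms(1), of "restrict x {0..T}" "restrict y {0..T}"]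
  by (simp add: xy_solutions_iff)

lemma zero_flow: "xy_flow \<eta> I (\<lambda>_. 0) (\<lambda>_. 0)"
  by (simp add: xy_flow_def)

lemma zero_solution_in: "0 < T \<Longrightarrow> zero_solution T \<in> xy_solutions \<eta> T"
  unfolding zero_solution_def by (rule restrict_flow_in_xy_solutions[OF zero_flow]) auto

text \<open>Shooting: since \<open>x 0 = 0\<close> is prescribed, \<open>y 0\<close> determines the
  trajectory on \<open>{0..T}\<close>, and extensionality turns this into equality of
  functions.\<close>

lemma inj_on_xy_solutions:
  assumes "0 \<le> \<eta>" "0 < T"
  shows "inj_on (\<lambda>p. snd p 0) (xy_solutions \<eta> T)"
proof (rule inj_onI, clarify)
  fix x\<^sub>1 y\<^sub>1 x\<^sub>2 y\<^sub>2
  assume s: "(x\<^sub>1, y\<^sub>1) \<in> xy_solutions \<eta> T" "(x\<^sub>2, y\<^sub>2) \<in> xy_solutions \<eta> T"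
    "snd (x\<^sub>1, y\<^sub>1) 0 = snd (x\<^sub>2, y\<^sub>2) 0"
  then have "x\<^sub>1 t = x\<^sub>2 t \<and> y\<^sub>1 t = y\<^sub>2 t" if "t \<in> {0..T}" for t
    using that assms
    by (intro xy_flow_unique[of \<eta> 0 T x\<^sub>1 y\<^sub>1 x\<^sub>2 y\<^sub>2 0 t]) (auto simp: xy_solutions_iff)
  then show "x\<^sub>1 = x\<^sub>2 \<and> y\<^sub>1 = y\<^sub>2"
    using s by (auto simp: xy_solutions_iff intro!: extensionalityI)
qed

lemma xy_solutions_minus:
  assumes "(x, y) \<in> xy_solutions \<eta> T" "0 < T"
  shows "(restrict (\<lambda>t. - x t) {0..T}, restrict (\<lambda>t. - y t) {0..T}) \<in> xy_solutions \<eta> T"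
  using assms by (intro restrict_flow_in_xy_solutions xy_flow_minus) (auto simp: xy_solutions_iff)

lemma (in subcritical) xy_solutions_start:
  assumes "0 < T"
  shows "(\<lambda>p. snd p 0) ` xy_solutions \<eta> T
    = insert 0 (hitting_amplitudes T \<union> uminus ` hitting_amplitudes T)"
proof (intro equalityI subsetI)
  fix a assume "a \<in> (\<lambda>p. snd p 0) ` xy_solutions \<eta> T"
  then obtain x y where s: "(x, y) \<in> xy_solutions \<eta> T" and a: "a = y 0" by auto
  consider "a = 0" | "0 < a" | "0 < - a" by linarith
  then show "a \<in> insert 0 (hitting_amplitudes T \<union> uminus ` hitting_amplitudes T)"
  proof cases
    case 2
    then show ?thesis
      using flow_hits_axis_iff[of T x y] s assms by (simp add: xy_solutions_iff a)
  next
    case 3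
    then have "- a \<in> hitting_amplitudes T"
      using flow_hits_axis_iff[of T "\<lambda>t. - x t" "\<lambda>t. - y t"] s assms
      by (simp add: xy_solutions_iff a xy_flow_minus)
    then have "- (- a) \<in> uminus ` hitting_amplitudes T" by (rule imageI)
    then show ?thesis by simp
  qed simp
next
  have pos: "\<exists>x y. (x, y) \<in> xy_solutions \<eta> T \<and> y 0 = a" if a: "a \<in> hitting_amplitudes T" for a
  proof -
    have "0 < a" "a < a\<^sub>s" using a by (auto simp: hitting_amplitudes_def)
    then obtain x y where flow: "xy_flow \<eta> {0..T} x y" "x 0 = 0" "y 0 = a"
    proof (rule orbit_exists)
      fix \<rho> \<beta> assume "\<And>I. xy_flow \<eta> I (\<lambda>t. \<rho> t * sin (\<beta> t) / \<omega>) (\<lambda>t. \<rho> t * sin (\<beta> t + \<gamma>) / \<omega>)"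
        "\<rho> 0 = a" "\<beta> 0 = 0"
      then show thesis
        using omega_pos
        by (intro that[of "\<lambda>t. \<rho> t * sin (\<beta> t) / \<omega>" "\<lambda>t. \<rho> t * sin (\<beta> t + \<gamma>) / \<omega>"])
           (auto simp: sin_gamma)
    qed
    then have "y T = 0" using flow_hits_axis_iff[of T x y] assms a \<open>0 < a\<close> by simp
    then have "(restrict x {0..T}, restrict y {0..T}) \<in> xy_solutions \<eta> T"
      using flow assms by (intro restrict_flow_in_xy_solutions) auto
    moreover have "restrict y {0..T} 0 = a" using flow assms by simp
    ultimately show ?thesis by blast
  qed
  fix a assume "a \<in> insert 0 (hitting_amplitudes T \<union> uminus ` hitting_amplitudes T)"
  then consider "a = 0" | "a \<in> hitting_amplitudes T" | "- a \<in> hitting_amplitudes T" by auto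
  then have "\<exists>x y. (x, y) \<in> xy_solutions \<eta> T \<and> y 0 = a"
  proof cases
    case 1
    then show ?thesis
      using zero_solution_in[OF assms] assms unfolding zero_solution_def
      by (intro exI[of _ "restrict (\<lambda>_. 0) {0..T}"]) auto
  next
    case 3
    then obtain x y where "(x, y) \<in> xy_solutions \<eta> T" "y 0 = - a" using pos by blast
    then show ?thesis
      using xy_solutions_minus[of x y] assms
      by (intro exI[of _ "restrict (\<lambda>t. - x t) {0..T}"] exI[of _ "restrict (\<lambda>t. - y t) {0..T}"]) auto
  qed (rule pos)
  then show "a \<in> (\<lambda>p. snd p 0) ` xy_solutions \<eta> T" by force
qed

lemma (in subcritical) card_xy_solutions:
  assumes "0 < T"
  shows "finite (xy_solutions \<eta> T)"
    and "card (xy_solutions \<eta> T) = 1 + 2 * nat \<lceil>(T - critical_time \<eta>) * sqrt (1 - 4 * \<eta>\<^sup>2) / pi\<rceil>"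
proof -
  let ?A = "hitting_amplitudes T"
  have fin: "finite ?A" and card: "card ?A = nat \<lceil>(T - critical_time \<eta>) * sqrt (1 - 4 * \<eta>\<^sup>2) / pi\<rceil>"
    using card_hitting_amplitudes[of T] by (auto simp: critical_time_def \<omega>_def \<gamma>_def)
  have bij: "bij_betw (\<lambda>p. snd p 0) (xy_solutions \<eta> T) (insert 0 (?A \<union> uminus ` ?A))"
    unfolding bij_betw_def using inj_on_xy_solutions[OF eta_nonneg assms] xy_solutions_start[OF assms] by simp
  then show "finite (xy_solutions \<eta> T)" using fin by (simp add: bij_betw_finite)
  have pos: "\<forall>a\<in>?A. 0 < a" by (simp add: hitting_amplitudes_def)
  have "card (insert 0 (?A \<union> uminus ` ?A)) = Suc (card (?A \<union> uminus ` ?A))"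
    using fin pos by (intro card_insert_disjoint) auto
  also have "card (?A \<union> uminus ` ?A) = card ?A + card (uminus ` ?A)"
  proof (rule card_Un_disjoint)
    have "x \<noteq> - y" if "x \<in> ?A" "y \<in> ?A" for x y
      using pos[rule_format, OF that(1)] pos[rule_format, OF that(2)] by linarith
    then show "?A \<inter> uminus ` ?A = {}" by blast
  qed (use fin in auto)
  also have "card (uminus ` ?A) = card ?A" by (intro card_image) (simp add: inj_on_def)
  finally show "card (xy_solutions \<eta> T) = 1 + 2 * nat \<lceil>(T - critical_time \<eta>) * sqrt (1 - 4 * \<eta>\<^sup>2) / pi\<rceil>"
    using bij_betw_same_card[OF bij] card by simp
qed

text \<open>For \<open>\<eta> \<ge> 1/2\<close> the energy is not positive on the diagonal of the positive quadrant.\<close>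

lemma xy_solutions_supercritical:
  assumes "1/2 \<le> \<eta>" "0 < T"
  shows "xy_solutions \<eta> T = {zero_solution T}"
proof -
  have no_pos: "\<not> 0 < y 0" if flow: "xy_flow \<eta> {0..T} x y" and bc: "x 0 = 0" "y T = 0" for x y
  proof
    assume "0 < y 0"
    then obtain t where t: "t \<in> {0..T}" "0 < y t" "x t = 1 * y t"
      using xy_flow_crosses_ray[OF flow \<open>0 < T\<close> bc(1) _ bc(2) zero_less_one] by metis
    have "(y 0)\<^sup>2 = xy_energy \<eta> (x t) (y t)"
      using xy_energy_conserved[OF flow, of 0 t] t \<open>0 < T\<close> bc by (simp add: xy_energy_def)
    also have "\<dots> = (2 - 4 * \<eta> - y t) * (y t)\<^sup>2"
      using t by (simp add: xy_energy_def algebra_simps power2_eq_square)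
    also have "\<dots> \<le> 0" using t assms by (intro mult_nonpos_nonneg) auto
    finally show False using \<open>0 < y 0\<close> by simp
  qed
  have "snd p 0 = 0" if "p \<in> xy_solutions \<eta> T" for p
  proof -
    obtain x y where p: "p = (x, y)" by (cases p)
    have "\<not> 0 < y 0" "\<not> 0 < - y 0"
      using no_pos[of x y] no_pos[of "\<lambda>t. - x t" "\<lambda>t. - y t"] that
      by (auto simp: xy_solutions_iff p xy_flow_minus)
    then show ?thesis by (simp add: p)
  qed
  moreover have zero: "zero_solution T \<in> xy_solutions \<eta> T" using zero_solution_in[OF \<open>0 < T\<close>] .
  moreover have "inj_on (\<lambda>p. snd p 0) (xy_solutions \<eta> T)"
    using assms by (intro inj_on_xy_solutions) auto
  ultimately have "p = zero_solution T" if "p \<in> xy_solutions \<eta> T" for p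
    using inj_onD[of "\<lambda>p. snd p 0"] that by metis
  then show ?thesis using zero by blast
qed

section \<open>Equivalence with the mean field game\<close>

lemma has_real_derivative_eq_on_interval:
  fixes f g :: "real \<Rightarrow> real"
  assumes "\<And>t. t \<in> {a..b} \<Longrightarrow> (f has_real_derivative h t) (at t within {a..b})"
    and "\<And>t. t \<in> {a..b} \<Longrightarrow> (g has_real_derivative h t) (at t within {a..b})"
    and "f b = g b" and "t \<in> {a..b}"
  shows "f t = g t"
proof -
  have "((\<lambda>t. f t - g t) has_real_derivative 0) (at t within {a..b})" if "t \<in> {a..b}" for t
    using DERIV_diff[OF assms(1)[OF that] assms(2)[OF that]] by simp
  then obtain c where "\<And>t. t \<in> {a..b} \<Longrightarrow> f t - g t = c"
    using has_field_derivative_zero_constant[of "{a..b}" "\<lambda>t. f t - g t"] by auto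
  from this[of t] this[of b] show ?thesis using assms by auto
qed

lemma terminal_value_problem:
  fixes h :: "real \<Rightarrow> real"
  assumes "continuous_on {0..T} h" "0 < T"
  obtains v where "v \<in> extensional {0..T}" "v T = 0"
    "\<And>t. t \<in> {0..T} \<Longrightarrow> (v has_real_derivative h t) (at t within {0..T})"
proof -
  obtain g where g: "\<And>t. t \<in> {0..T} \<Longrightarrow> (g has_real_derivative h t) (at t within {0..T})"
    using antiderivative_continuous[OF assms(1)]
    by (auto simp: has_real_derivative_iff_has_vector_derivative)
  define v where "v = restrict (\<lambda>t. g t - g T) {0..T}"
  have "(v has_real_derivative h t) (at t within {0..T})" if t: "t \<in> {0..T}" for t
  proof (rule has_field_derivative_transform_within[OF _ zero_less_one t, of "\<lambda>t. g t - g T"])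
    show "((\<lambda>t. g t - g T) has_real_derivative h t) (at t within {0..T})"
      using g[OF t] by (auto intro!: derivative_eq_intros)
  qed (auto simp: v_def)
  then show ?thesis using that[of v] assms by (auto simp: v_def)
qed

text \<open>The right-hand side of the equation for \<open>u i\<close> as a function of \<open>\<theta>\<close> and \<open>u 1 - u 0\<close>.\<close>

definition value_rate :: "real \<Rightarrow> nat \<Rightarrow> real \<Rightarrow> real \<Rightarrow> real" where
  "value_rate \<eta> i \<theta> z = - (crowd_cost i \<theta> - \<eta> * (if i = 0 then - z else z)
     - 1/2 * (max (if i = 0 then - z else z) 0)\<^sup>2)"

text \<open>The squares of the positive parts of \<open>z\<close> and \<open>- z\<close> differ by
  \<open>z * \<bar>z\<bar>\<close>.\<close>

lemma value_rate_diff: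
  "value_rate \<eta> 1 \<theta> z - value_rate \<eta> 0 \<theta> z = - ((2 * \<theta> - 1) - 1/2 * z * \<bar>z\<bar> - 2 * \<eta> * z)"
  by (cases "0 \<le> z") (simp_all add: value_rate_def crowd_cost_def algebra_simps power2_eq_square)

lemma state_rate:
  fixes \<theta> \<eta> p q :: real
  shows "2 * ((1 - \<theta>) * (max (p - q) 0 + \<eta>) - \<theta> * (max (q - p) 0 + \<eta>))
    = (p - q) - (2 * \<theta> - 1) * \<bar>p - q\<bar> - 2 * \<eta> * (2 * \<theta> - 1)"
  by (cases "q \<le> p") (simp_all add: max_def algebra_simps)

lemma mfg_equilibria_iff:
  "(\<theta>, u) \<in> mfg_equilibria \<eta> T \<longleftrightarrow>
     \<theta> \<in> extensional {0..T} \<and> u \<in> (\<Pi>\<^sub>E i\<in>{0, 1}. extensional {0..T}) \<and>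
     (\<forall>t\<in>{0..T}. (\<theta> has_real_derivative
        (1 - \<theta> t) * (max (u 1 t - u 0 t) 0 + \<eta>) - \<theta> t * (max (u 0 t - u 1 t) 0 + \<eta>))
        (at t within {0..T})) \<and>
     (\<forall>i\<in>{0, 1}. \<forall>t\<in>{0..T}.
        (u i has_real_derivative value_rate \<eta> i (\<theta> t) (u 1 t - u 0 t)) (at t within {0..T})) \<and>
     \<theta> 0 = 1 / 2 \<and> (\<forall>i\<in>{0, 1}. u i T = 0)"
  by (simp add: mfg_equilibria_def value_rate_def)

lemma mfg_equilibriaD:
  assumes "(\<theta>, u) \<in> mfg_equilibria \<eta> T"
  shows "\<theta> \<in> extensional {0..T}" and "u \<in> (\<Pi>\<^sub>E i\<in>{0, 1}. extensional {0..T})"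
    and "t \<in> {0..T} \<Longrightarrow> (\<theta> has_real_derivative
        (1 - \<theta> t) * (max (u 1 t - u 0 t) 0 + \<eta>) - \<theta> t * (max (u 0 t - u 1 t) 0 + \<eta>))
        (at t within {0..T})"
    and "i \<in> {0, 1} \<Longrightarrow> t \<in> {0..T} \<Longrightarrow>
        (u i has_real_derivative value_rate \<eta> i (\<theta> t) (u 1 t - u 0 t)) (at t within {0..T})"
    and "\<theta> 0 = 1 / 2" and "i \<in> {0, 1} \<Longrightarrow> u i T = 0"
proof -
  note c1 = assms[unfolded mfg_equilibria_iff]
  note c2 = conjunct2[OF c1] note c3 = conjunct2[OF c2]
  note c4 = conjunct2[OF c3] note c5 = conjunct2[OF c4]
  show "\<theta> \<in> extensional {0..T}" by (rule conjunct1[OF c1])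
  show "u \<in> (\<Pi>\<^sub>E i\<in>{0, 1}. extensional {0..T})" by (rule conjunct1[OF c2])
  show "(\<theta> has_real_derivative
        (1 - \<theta> t) * (max (u 1 t - u 0 t) 0 + \<eta>) - \<theta> t * (max (u 0 t - u 1 t) 0 + \<eta>))
        (at t within {0..T})" if "t \<in> {0..T}"
    by (rule bspec[OF conjunct1[OF c3] that])
  show "(u i has_real_derivative value_rate \<eta> i (\<theta> t) (u 1 t - u 0 t)) (at t within {0..T})"
    if "i \<in> {0, 1}" "t \<in> {0..T}"
    by (rule bspec[OF bspec[OF conjunct1[OF c4] that(1)] that(2)])
  show "\<theta> 0 = 1 / 2" by (rule conjunct1[OF c5])
  show "u i T = 0" if "i \<in> {0, 1}" by (rule bspec[OF conjunct2[OF c5] that])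
qed

lemma to_xy_in_xy_solutions:
  assumes "(\<theta>, u) \<in> mfg_equilibria \<eta> T" "0 < T"
  shows "to_xy T (\<theta>, u) \<in> xy_solutions \<eta> T"
proof -
  note mfg = mfg_equilibriaD[OF assms(1)]
  have "xy_flow \<eta> {0..T} (\<lambda>t. 2 * \<theta> t - 1) (\<lambda>t. u 1 t - u 0 t)"
    unfolding xy_flow_def
  proof (intro ballI conjI)
    fix t assume t: "t \<in> {0..T}"
    then have "((\<lambda>t. 2 * \<theta> t - 1) has_real_derivative 2 * ((1 - \<theta> t) * (max (u 1 t - u 0 t) 0 + \<eta>)
        - \<theta> t * (max (u 0 t - u 1 t) 0 + \<eta>)) - 0) (at t within {0..T})"
      using mfg(3) by (intro DERIV_diff DERIV_cmult DERIV_const)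
    then show "((\<lambda>t. 2 * \<theta> t - 1) has_real_derivative
        (u 1 t - u 0 t) - (2 * \<theta> t - 1) * \<bar>u 1 t - u 0 t\<bar> - 2 * \<eta> * (2 * \<theta> t - 1)) (at t within {0..T})"
      unfolding state_rate by simp
    have "((\<lambda>t. u 1 t - u 0 t) has_real_derivative
        value_rate \<eta> 1 (\<theta> t) (u 1 t - u 0 t) - value_rate \<eta> 0 (\<theta> t) (u 1 t - u 0 t)) (at t within {0..T})"
      using mfg(4)[of _ t] t by (intro DERIV_diff) simp_all
    then show "((\<lambda>t. u 1 t - u 0 t) has_real_derivative
        - (2 * \<theta> t - 1 - 1/2 * (u 1 t - u 0 t) * \<bar>u 1 t - u 0 t\<bar> - 2 * \<eta> * (u 1 t - u 0 t)))
        (at t within {0..T})"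
      unfolding value_rate_diff .
  qed
  then show ?thesis
    unfolding to_xy_def using restrict_flow_in_xy_solutions[of \<eta> T] mfg(5,6) \<open>0 < T\<close> by simp
qed

text \<open>Both rates of \<open>u\<close> depend on the equilibrium only through \<theta> and
  \<open>u 1 - u 0\<close>. So \<open>(x, y)\<close> determines \<open>u\<close> by integration from
  the terminal value \<open>0\<close>, and conversely any solution lifts this way.\<close>

lemma bij_betw_to_xy:
  assumes "0 < T"
  shows "bij_betw (to_xy T) (mfg_equilibria \<eta> T) (xy_solutions \<eta> T)"
proof (rule bij_betwI')
  fix p q assume p: "p \<in> mfg_equilibria \<eta> T" and q: "q \<in> mfg_equilibria \<eta> T"
  obtain \<theta> u \<theta>' u' where [simp]: "p = (\<theta>, u)" "q = (\<theta>', u')" by (cases p, cases q)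
  note mp = mfg_equilibriaD[OF p[simplified]] and mq = mfg_equilibriaD[OF q[simplified]]
  have "p = q" if eq: "to_xy T p = to_xy T q"
  proof -
    have \<theta>: "\<theta> t = \<theta>' t" and z: "u 1 t - u 0 t = u' 1 t - u' 0 t" if "t \<in> {0..T}" for t
      using eq that by (auto simp: to_xy_def dest!: fun_cong[of _ _ t])
    have u: "u i t = u' i t" if i: "i \<in> {0, 1}" and t: "t \<in> {0..T}" for i t
    proof (rule has_real_derivative_eq_on_interval[OF _ _ _ t])
      fix s assume s: "s \<in> {0..T}"
      show "(u i has_real_derivative value_rate \<eta> i (\<theta> s) (u 1 s - u 0 s)) (at s within {0..T})"
        by (rule mp(4)[OF i s])
      show "(u' i has_real_derivative value_rate \<eta> i (\<theta> s) (u 1 s - u 0 s)) (at s within {0..T})"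
        unfolding \<theta>[OF s] z[OF s] by (rule mq(4)[OF i s])
    next
      show "u i T = u' i T" using mp(6)[OF i] mq(6)[OF i] by simp
    qed
    have "\<theta> = \<theta>'" by (rule extensionalityI[OF mp(1) mq(1) \<theta>])
    moreover have "u = u'"
      by (rule PiE_ext[OF mp(2) mq(2)]) (rule extensionalityI[OF PiE_mem[OF mp(2)] PiE_mem[OF mq(2)] u])
    ultimately show ?thesis by simp
  qed
  then show "(to_xy T p = to_xy T q) = (p = q)" by auto
next
  fix p assume "p \<in> mfg_equilibria \<eta> T"
  then show "to_xy T p \<in> xy_solutions \<eta> T"
    using to_xy_in_xy_solutions[of "fst p" "snd p"] assms by simp
next
  fix p assume "p \<in> xy_solutions \<eta> T"
  then obtain x y where p: "p = (x, y)" and "(x, y) \<in> xy_solutions \<eta> T" by (cases p) auto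
  then have ext: "x \<in> extensional {0..T}" "y \<in> extensional {0..T}"
    and flow: "xy_flow \<eta> {0..T} x y" and bc: "x 0 = 0" "y T = 0"
    by (auto simp: xy_solutions_iff)
  define \<theta> where "\<theta> = (\<lambda>t\<in>{0..T}. (x t + 1) / 2)"
  have \<theta>: "2 * \<theta> t - 1 = x t" if "t \<in> {0..T}" for t using that by (simp add: \<theta>_def field_simps)
  define Q where "Q i v \<longleftrightarrow> v \<in> extensional {0..T} \<and> v T = 0 \<and> (\<forall>t\<in>{0..T}.
      (v has_real_derivative value_rate \<eta> i ((x t + 1) / 2) (y t)) (at t within {0..T}))" for i v
  have "\<exists>v. Q i v" for i
  proof -
    have "continuous_on {0..T} (\<lambda>t. value_rate \<eta> i ((x t + 1) / 2) (y t))"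
      using xy_flow_continuous[OF flow]
      by (cases "i = 0") (auto simp: value_rate_def crowd_cost_def intro!: continuous_intros)
    then obtain v where "v \<in> extensional {0..T}" "v T = 0" "\<And>t. t \<in> {0..T} \<Longrightarrow>
        (v has_real_derivative value_rate \<eta> i ((x t + 1) / 2) (y t)) (at t within {0..T})"
      by (rule terminal_value_problem[OF _ assms]) blast
    then have "Q i v" by (simp add: Q_def)
    then show ?thesis by blast
  qed
  then have "\<exists>v. \<forall>i. Q i (v i)" by (intro choice allI)
  then obtain v where "\<And>i. Q i (v i)" by auto
  then have v: "\<And>i. v i \<in> extensional {0..T}" "\<And>i. v i T = 0"
    "\<And>i t. t \<in> {0..T} \<Longrightarrow>
      (v i has_real_derivative value_rate \<eta> i ((x t + 1) / 2) (y t)) (at t within {0..T})"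
    by (simp_all add: Q_def)
  define u :: "nat \<Rightarrow> real \<Rightarrow> real" where "u = restrict v {0, 1}"
  have u: "u 0 = v 0" "u 1 = v 1" by (simp_all add: u_def)
  \<comment> \<open>Consistency: the value functions were integrated with \<open>y\<close> in place
    of their difference; that difference has the same derivative and terminal value as
    \<open>y\<close>, hence equals it.\<close>
  have y: "v 1 t - v 0 t = y t" if t: "t \<in> {0..T}" for t
  proof (rule has_real_derivative_eq_on_interval[OF _ _ _ t])
    fix s assume s: "s \<in> {0..T}"
    have eq: "2 * ((x s + 1) / 2) - 1 = x s" by (simp add: field_simps)
    show "((\<lambda>t. v 1 t - v 0 t) has_real_derivative - (x s - 1/2 * y s * \<bar>y s\<bar> - 2 * \<eta> * y s)) (at s within {0..T})"
      using DERIV_diff[OF v(3)[OF s, of 1] v(3)[OF s, of 0]] unfolding value_rate_diff eq .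
    show "(y has_real_derivative - (x s - 1/2 * y s * \<bar>y s\<bar> - 2 * \<eta> * y s)) (at s within {0..T})"
      by (rule xy_flowD(2)[OF flow s])
  qed (simp add: v bc)
  have half: "b / 2 = a" if "2 * a = b" for a b :: real using that by simp
  have "(\<theta>, u) \<in> mfg_equilibria \<eta> T"
    unfolding mfg_equilibria_iff
  proof (intro conjI ballI)
    fix t assume t: "t \<in> {0..T}"
    have "((\<lambda>t. (x t + 1) / 2) has_real_derivative
        (y t - x t * \<bar>y t\<bar> - 2 * \<eta> * x t) / 2) (at t within {0..T})"
      using xy_flowD(1)[OF flow t] by (auto intro!: derivative_eq_intros)
    then have "(\<theta> has_real_derivative (y t - x t * \<bar>y t\<bar> - 2 * \<eta> * x t) / 2) (at t within {0..T})"
      by (rule has_field_derivative_transform_within[OF _ zero_less_one t]) (simp add: \<theta>_def)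
    moreover have "2 * ((1 - \<theta> t) * (max (u 1 t - u 0 t) 0 + \<eta>) - \<theta> t * (max (u 0 t - u 1 t) 0 + \<eta>))
        = y t - x t * \<bar>y t\<bar> - 2 * \<eta> * x t"
      unfolding state_rate unfolding \<theta>[OF t] u y[OF t] ..
    then have "(y t - x t * \<bar>y t\<bar> - 2 * \<eta> * x t) / 2
        = (1 - \<theta> t) * (max (u 1 t - u 0 t) 0 + \<eta>) - \<theta> t * (max (u 0 t - u 1 t) 0 + \<eta>)"
      by (rule half)
    ultimately show "(\<theta> has_real_derivative (1 - \<theta> t) * (max (u 1 t - u 0 t) 0 + \<eta>)
        - \<theta> t * (max (u 0 t - u 1 t) 0 + \<eta>)) (at t within {0..T})"
      by (simp only:)
    fix i :: nat assume "i \<in> {0, 1}"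
    then have "u i = v i" by (simp add: u_def)
    moreover have "\<theta> t = (x t + 1) / 2" using t by (simp add: \<theta>_def)
    ultimately show "(u i has_real_derivative value_rate \<eta> i (\<theta> t) (u 1 t - u 0 t)) (at t within {0..T})"
      unfolding u y[OF t] by (simp only: v(3)[OF t])
  next
    show "u \<in> (\<Pi>\<^sub>E i\<in>{0, 1}. extensional {0..T})" unfolding u_def using v(1) by simp
    show "u i T = 0" if "i \<in> {0, 1}" for i using that v(2) by (simp add: u_def)
    show "\<theta> 0 = 1 / 2" using assms bc by (simp add: \<theta>_def)
  qed (simp add: \<theta>_def)
  moreover have "to_xy T (\<theta>, u) = (x, y)"
  proof -
    have "(\<lambda>t\<in>{0..T}. 2 * \<theta> t - 1) = x" "(\<lambda>t\<in>{0..T}. u 1 t - u 0 t) = y"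
      by (rule extensionalityI[OF restrict_extensional ext(1)], simp only: restrict_apply' \<theta>)
         (rule extensionalityI[OF restrict_extensional ext(2)], simp only: restrict_apply' u y)
    then show ?thesis by (simp add: to_xy_def)
  qed
  ultimately show "\<exists>q\<in>mfg_equilibria \<eta> T. p = to_xy T q" unfolding p by (intro bexI[of _ "(\<theta>, u)"]) simp_all
qed

theorem mainTheorem2:
  fixes \<eta> T :: real
  assumes "\<eta> \<ge> 0" and "T > 0"
  shows "bij_betw (to_xy T) (mfg_equilibria \<eta> T) (xy_solutions \<eta> T) \<and>
    (\<eta> \<ge> 1 / 2 \<longrightarrow> xy_solutions \<eta> T = {zero_solution T}) \<and>
    (\<eta> < 1 / 2 \<longrightarrow>
       finite (xy_solutions \<eta> T) \<and>
       int (card (xy_solutions \<eta> T)) =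
         1 + 2 * \<lceil>(T - critical_time \<eta>) * sqrt (1 - 4 * \<eta>\<^sup>2) / pi\<rceil> \<and>
       (T \<le> critical_time \<eta> \<longrightarrow> xy_solutions \<eta> T = {zero_solution T}))"
proof (intro conjI impI)
  show "bij_betw (to_xy T) (mfg_equilibria \<eta> T) (xy_solutions \<eta> T)"
    by (rule bij_betw_to_xy[OF \<open>T > 0\<close>])
  show "xy_solutions \<eta> T = {zero_solution T}" if "\<eta> \<ge> 1 / 2"
    using xy_solutions_supercritical[OF that \<open>T > 0\<close>] .
next
  assume "\<eta> < 1 / 2"
  then interpret subcritical \<eta> using assms(1) by unfold_locales
  let ?v = "(T - critical_time \<eta>) * sqrt (1 - 4 * \<eta>\<^sup>2) / pi"
  show "finite (xy_solutions \<eta> T)" by (rule card_xy_solutions(1)[OF \<open>T > 0\<close>])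
  \<comment> \<open>Since \<open>T * \<omega>\<close> and \<gamma> are positive, \<open>?v\<close>
    exceeds \<open>- 1\<close>; its ceiling is therefore nonnegative and \<open>nat\<close> does not
    truncate it.\<close>
  have "?v = (T * \<omega> - (pi - \<gamma>)) / pi"
    unfolding critical_time_def left_diff_distrib \<omega>_def[symmetric] \<gamma>_def[symmetric]
    using omega_pos by simp
  moreover have "- pi < T * \<omega> - (pi - \<gamma>)"
    using mult_pos_pos[OF \<open>T > 0\<close> omega_pos] gamma_pos by linarith
  ultimately have "- 1 < ?v" by (simp add: pos_less_divide_eq)
  then have "0 \<le> \<lceil>?v\<rceil>" by linarith
  then show "int (card (xy_solutions \<eta> T)) = 1 + 2 * \<lceil>?v\<rceil>"
    using card_xy_solutions(2)[OF \<open>T > 0\<close>] by simp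
  assume "T \<le> critical_time \<eta>"
  then have "?v \<le> 0" using omega_pos by (simp add: divide_nonpos_pos mult_nonpos_nonneg flip: \<omega>_def)
  then have "card (xy_solutions \<eta> T) = 1" using card_xy_solutions(2)[OF \<open>T > 0\<close>] by simp
  then obtain p where "xy_solutions \<eta> T = {p}" by (rule card_1_singletonE)
  then show "xy_solutions \<eta> T = {zero_solution T}"
    using zero_solution_in[OF \<open>T > 0\<close>, of \<eta>] by simp
qed

end
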